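(* Let $\mathbb{F}$ be a field of characteristic zero. For a polynomial map $P:\mathbb{F}^n\to\mathbb{F}^n$, $P(x)=(x_1+f_1(x),\dots,x_n+f_n(x))$, $n\ge 2$, where each $f_i$ is a polynomial all of whose terms have degree at least $2$ (or $f_i=0$), the Jacobian equation $J(P)=1$ is equivalent to the first-order equation $E_1(F)+E_2(F)+\cdots+E_n(F)=0$, where $F=(\partial f_i/\partial x_j)$. Moreover: (i) ($n=2$; write $P(x,y)=(x+f(x,y),\,y+g(x,y))$.) If $f_x+g_y=0$, then there is a polynomial $h(x,y)$ with $f=h_y$, $g=-h_x$, and then $J(P)=1$ if and only if $h_{xx}h_{yy}-h_{xy}^2=0$. For all $a,b\in\mathbb{F}$ and every one-variable polynomial $\sigma$ all of whose terms have degree at least $3$ (or $\sigma=0$), $h(x,y)=\sigma(ax+by)$ solves this last equation. The associated map $(u,v)=P(x,y)$, with $\xi=ax+by$, $$u=x+b\,\sigma'(\xi),\qquad v=y-a\,\sigma'(\xi),$$ satisfies $J(P)=1$ and $au+bv=ax+by=\xi$, and has the polynomial inverse $$x=u-b\,\sigma'(\xi),\qquad y=v+a\,\sigma'(\xi),\qquad \xi=au+bv.$$ Furthermore $\deg(P^{-1})=\deg(P)$, and every integer $d\ge 2$ occurs as $\deg(P)$ in this family. (ii) ($n=3$; write $P(x,y,z)=(x+f,\,y+g,\,z+h)$.) If $f_x+g_y+h_z=0$, then there are polynomials $A,B,C$ in $x,y,z$ with $(f,g,h)=(C_y-B_z,\,A_z-C_x,\,B_x-A_y)$, and then $J(P)=1$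 if and only if $$\begin{vmatrix} C_{xy}-B_{xz} & C_{yy}-B_{yz} \\ {} A_{xz}-C_{xx} & A_{yz}-C_{xy} \end{vmatrix}+\begin{vmatrix} A_{yz}-C_{xy} & A_{zz}-C_{xz} \\ {} B_{xy}-A_{yy} & B_{xz}-A_{yz} \end{vmatrix}+\begin{vmatrix} C_{xy}-B_{xz} & C_{yz}-B_{zz} \\ {} B_{xx}-A_{xy} & B_{xz}-A_{yz} \end{vmatrix}+\begin{vmatrix} C_{xy}-B_{xz} & C_{yy}-B_{yz} & C_{yz}-B_{zz} \\ {} A_{xz}-C_{xx} & A_{yz}-C_{xy} & A_{zz}-C_{xz} \\ {} B_{xx}-A_{xy} & B_{xy}-A_{yy} & B_{xz}-A_{yz} \end{vmatrix}=0.$$ Let $\phi,\psi$ be arbitrary one-variable polynomials whose terms all have degree at least $2$. (ii-a) For $a,b,c\in\mathbb{F}$ with $c\ne0$, the map $(u,v,w)=P(x,y,z)$ given, with $\xi=ax+by+cz$, by $$u=x+\phi(\xi),\quad v=y+\psi(\xi),\quad w=z-\tfrac ac\phi(\xi)-\tfrac bc\psi(\xi)$$ satisfies $J(P)=1$ and $au+bv+cw=\xi$, and has the polynomial inverse $x=u-\phi(\xi)$, $y=v-\psi(\xi)$, $z=w+\frac ac\phi(\xi)+\frac bc\psi(\xi)$ with $\xi=au+bv+cw$; in particular $\deg(P^{-1})=\deg(P)$. (ii-b) For $a,b,c,p,q,r\in\mathbb{F}$ with $c\neq0$, $r\ne0$, such that exactly one of the equalities $ar=cp$, $br=cq$ holds,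 the map $(u,v,w)=P(x,y,z)$ given, with $\xi=ax+by+cz$, $\eta=px+qy+rz$, by $$u=x+\phi(\xi),\quad v=y+\psi(\eta),\quad w=z-\tfrac ac\phi(\xi)-\tfrac qr\psi(\eta)$$ satisfies $J(P)=1$ and has the polynomial inverse $$x=u-\phi(\xi),\quad y=v-\psi(\eta),\quad z=w+\tfrac ac\phi(\xi)+\tfrac qr\psi(\eta),$$ where, if $ar=cp$ and $br\neq cq$, one has $\eta=pu+qv+rw$ and $\xi=au+bv+cw-\left(b-\frac{cq}{r}\right)\psi(\eta)$; and, if $br=cq$ and $ar\ne cp$, one has $\xi=au+bv+cw$ and $\eta=pu+qv+rw-\left(p-\frac{ar}{c}\right)\phi(\xi)$. In this family $\deg(P^{-1})\le(\deg P)^2$, and for every integer $d\geq2$ there is a member with $\deg(P)=d$ and $\deg(P^{-1})=d^2$. (iii) For every $n\ge2$, all $a_1,\dots,a_n\in\mathbb{F}$ with $a_n\ne0$, and arbitrary one-variable polynomials $\phi_1,\dots,\phi_{n-1}$ of any prescribed degrees whose terms all have degree at least $2$, the map $u=P(x)$ given, with $\xi=a_1x_1+\cdots+a_nx_n$, by $$u_i=x_i+\phi_i(\xi)\ (i=1,\dots,n-1),\qquad u_n=x_n-\sum_{i=1}^{n-1}\frac{a_i}{a_n}\phi_i(\xi)$$ satisfies $J(P)=1$ and $a_1u_1+\cdots+a_nu_n=\xi$, and has the polynomial inverse $$x_i=u_i-\phi_i(\xi)\ (i=1,\dots,n-1),\qquad x_n=u_n+\sum_{i=1}^{n-1}\frac{a_i}{a_n}\phi_i(\xi),\qquad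 \xi=a_1u_1+\cdots+a_nu_n;$$ in particular $\deg(P^{-1})=\deg(P)$.
   Context: $\mathbb{F}$ is a field of characteristic zero; derivatives of polynomials are formal, and subscripts $x,y,z$ denote partial derivatives. For a polynomial map $P:\mathbb{F}^n\to\mathbb{F}^n$, $J(P)$ is the determinant of its Jacobian matrix, and $\deg(P)$ is the maximum of the total degrees of its components. A polynomial inverse of $P$ is a polynomial map $Q$ with $P\circ Q=Q\circ P=\mathrm{id}$; it is denoted $P^{-1}$. For an $n\times n$ matrix $F$, $E_k(F)$ denotes the sum of all $k\times k$ principal minors of $F$, so $E_1(F)=\mathrm{tr}(F)$ and $E_n(F)=\det(F)$. *)

theory Defs
  imports
    "HOL-Library.Poly_Mapping"
    "HOL-Computational_Algebra.Polynomial"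
    "Jordan_Normal_Form.Matrix"
    "Jordan_Normal_Form.Determinant"
    "Jordan_Normal_Form.DL_Submatrix"
begin

text \<open>
  A polynomial in the variables with indices 0, 1, 2, ... is a finitely supported function from
  exponent vectors to coefficients; the ring structure (convolution product) is that of
  \<^theory>\<open>HOL-Library.Poly_Mapping\<close>.
\<close>

type_synonym 'a mpoly = "(nat \<Rightarrow>\<^sub>0 nat) \<Rightarrow>\<^sub>0 'a"

definition Const :: "'a::zero \<Rightarrow> 'a mpoly" where
  "Const c = Poly_Mapping.single 0 c"

definition Var :: "nat \<Rightarrow> 'a::zero_neq_one mpoly" where
  "Var i = Poly_Mapping.single (Poly_Mapping.single i 1) 1"

definition vars :: "'a::zero mpoly \<Rightarrow> nat set" where
  "vars p = (\<Union>m \<in> Poly_Mapping.keys p. Poly_Mapping.keys m)"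

definition mdeg :: "(nat \<Rightarrow>\<^sub>0 nat) \<Rightarrow> nat" where
  "mdeg m = (\<Sum>i \<in> Poly_Mapping.keys m. Poly_Mapping.lookup m i)"

text \<open>The total degree, with value 0 at the zero polynomial.\<close>

definition total_degree :: "'a::zero mpoly \<Rightarrow> nat" where
  "total_degree p = Max (insert 0 (mdeg ` Poly_Mapping.keys p))"

text \<open>All terms have degree at least \<open>k\<close>; both predicates hold for the zero polynomial.\<close>

definition terms_ge :: "nat \<Rightarrow> 'a::zero mpoly \<Rightarrow> bool" where
  "terms_ge k p \<longleftrightarrow> (\<forall>m \<in> Poly_Mapping.keys p. k \<le> mdeg m)"

definition uterms_ge :: "nat \<Rightarrow> 'a::zero poly \<Rightarrow> bool" where
  "uterms_ge k s \<longleftrightarrow> (\<forall>i<k. coeff s i = 0)"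

text \<open>
  Formal partial derivative with respect to the variable of index \<open>i\<close>. A monomial not containing
  that variable gets the coefficient 0, so the truncated subtraction of exponents is harmless.
\<close>

definition pd :: "nat \<Rightarrow> 'a::comm_ring_1 mpoly \<Rightarrow> 'a mpoly" where
  "pd i p = (\<Sum>m \<in> Poly_Mapping.keys p.
     Poly_Mapping.single (m - Poly_Mapping.single i 1)
       (of_nat (Poly_Mapping.lookup m i) * Poly_Mapping.lookup p m))"

text \<open>In subscript order: \<open>pd2 0 1 h\<close> is $h_{xy}$.\<close>

definition pd2 :: "nat \<Rightarrow> nat \<Rightarrow> 'a::comm_ring_1 mpoly \<Rightarrow> 'a mpoly" where
  "pd2 i j p = pd j (pd i p)"

definition psubst :: "(nat \<Rightarrow> 'a::comm_ring_1 mpoly) \<Rightarrow> 'a mpoly \<Rightarrow> 'a mpoly" where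
  "psubst q p = (\<Sum>m \<in> Poly_Mapping.keys p.
     Const (Poly_Mapping.lookup p m) *
     (\<Prod>i \<in> Poly_Mapping.keys m. q i ^ Poly_Mapping.lookup m i))"

text \<open>The value of a one-variable polynomial at a polynomial in several variables.\<close>

definition poly_at :: "'a::comm_ring_1 poly \<Rightarrow> 'a mpoly \<Rightarrow> 'a mpoly" where
  "poly_at s p = poly (map_poly Const s) p"

text \<open>
  A polynomial map of affine n-space is the vector of its n components, each a polynomial in the
  variables with indices below n.
\<close>

definition poly_map :: "nat \<Rightarrow> 'a::zero mpoly vec \<Rightarrow> bool" where
  "poly_map n P \<longleftrightarrow> P \<in> carrier_vec n \<and> (\<forall>i<n. vars (P $ i) \<subseteq> {..<n})"

definition pm_id :: "nat \<Rightarrow> 'a::zero_neq_one mpoly vec" where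
  "pm_id n = vec n Var"

definition pm_comp :: "'a::comm_ring_1 mpoly vec \<Rightarrow> 'a mpoly vec \<Rightarrow> 'a mpoly vec" where
  "pm_comp P Q = map_vec (psubst (\<lambda>i. Q $ i)) P"

definition pm_deg :: "'a::zero mpoly vec \<Rightarrow> nat" where
  "pm_deg P = Max ((\<lambda>i. total_degree (P $ i)) ` {..<dim_vec P})"

definition is_inverse :: "nat \<Rightarrow> 'a::comm_ring_1 mpoly vec \<Rightarrow> 'a mpoly vec \<Rightarrow> bool" where
  "is_inverse n P Q \<longleftrightarrow>
     poly_map n P \<and> poly_map n Q \<and> pm_comp P Q = pm_id n \<and> pm_comp Q P = pm_id n"

text \<open>
  The polynomial inverse; it is unique if it exists, and unspecified otherwise.
\<close>

definition pm_inv :: "'a::comm_ring_1 mpoly vec \<Rightarrow> 'a mpoly vec" where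
  "pm_inv P = (THE Q. is_inverse (dim_vec P) P Q)"

definition jacobian :: "'a::comm_ring_1 mpoly vec \<Rightarrow> 'a mpoly mat" where
  "jacobian P = mat (dim_vec P) (dim_vec P) (\<lambda>(i, j). pd j (P $ i))"

definition J :: "'a::comm_ring_1 mpoly vec \<Rightarrow> 'a mpoly" where
  "J P = det (jacobian P)"

definition E :: "nat \<Rightarrow> 'a::comm_ring_1 mat \<Rightarrow> 'a" where
  "E k A = (\<Sum>I | I \<subseteq> {..<dim_row A} \<and> card I = k. det (submatrix A I I))"

text \<open>The tuples $(f_1,\dots,f_n)$ of the maps $P(x) = (x_1+f_1(x),\dots,x_n+f_n(x))$.\<close>

definition perturbation :: "nat \<Rightarrow> 'a::zero mpoly vec \<Rightarrow> bool" where
  "perturbation n f \<longleftrightarrow> poly_map n f \<and> (\<forall>i<n. terms_ge 2 (f $ i))"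

definition lin2 :: "'a::comm_ring_1 \<Rightarrow> 'a \<Rightarrow> 'a mpoly" where
  "lin2 a b = Const a * Var 0 + Const b * Var 1"

definition lin3 :: "'a::comm_ring_1 \<Rightarrow> 'a \<Rightarrow> 'a \<Rightarrow> 'a mpoly" where
  "lin3 a b c = Const a * Var 0 + Const b * Var 1 + Const c * Var 2"

definition lin :: "nat \<Rightarrow> (nat \<Rightarrow> 'a::comm_ring_1) \<Rightarrow> 'a mpoly" where
  "lin n a = (\<Sum>i<n. Const (a i) * Var i)"

definition fam2 :: "'a::field_char_0 \<Rightarrow> 'a \<Rightarrow> 'a poly \<Rightarrow> 'a mpoly vec" where
  "fam2 a b \<sigma> = (let \<xi> = lin2 a b in
     vec_of_list
      [Var 0 + Const b * poly_at (pderiv \<sigma>) \<xi>,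
       Var 1 - Const a * poly_at (pderiv \<sigma>) \<xi>])"

definition fam3a :: "'a::field_char_0 \<Rightarrow> 'a \<Rightarrow> 'a \<Rightarrow> 'a poly \<Rightarrow> 'a poly \<Rightarrow> 'a mpoly vec" where
  "fam3a a b c \<phi> \<psi> = (let \<xi> = lin3 a b c in
     vec_of_list
      [Var 0 + poly_at \<phi> \<xi>,
       Var 1 + poly_at \<psi> \<xi>,
       Var 2 - Const (a / c) * poly_at \<phi> \<xi> - Const (b / c) * poly_at \<psi> \<xi>])"

definition fam3b :: "'a::field_char_0 \<Rightarrow> 'a \<Rightarrow> 'a \<Rightarrow> 'a \<Rightarrow> 'a \<Rightarrow> 'a \<Rightarrow> 'a poly \<Rightarrow> 'a poly \<Rightarrow> 'a mpoly vec"
  where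
  "fam3b a b c p q r \<phi> \<psi> = (let \<xi> = lin3 a b c; \<eta> = lin3 p q r in
     vec_of_list
      [Var 0 + poly_at \<phi> \<xi>,
       Var 1 + poly_at \<psi> \<eta>,
       Var 2 - Const (a / c) * poly_at \<phi> \<xi> - Const (q / r) * poly_at \<psi> \<eta>])"

definition params3b ::
  "'a::field_char_0 \<Rightarrow> 'a \<Rightarrow> 'a \<Rightarrow> 'a \<Rightarrow> 'a \<Rightarrow> 'a \<Rightarrow> 'a poly \<Rightarrow> 'a poly \<Rightarrow> bool" where
  "params3b a b c p q r \<phi> \<psi> \<longleftrightarrow>
     c \<noteq> 0 \<and> r \<noteq> 0 \<and> ((a * r = c * p) \<noteq> (b * r = c * q)) \<and>
     uterms_ge 2 \<phi> \<and> uterms_ge 2 \<psi>"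

text \<open>The index i of the mathematical notation is i - 1 here, so \<open>a (n - 1)\<close> is $a_n$.\<close>

definition famn :: "nat \<Rightarrow> (nat \<Rightarrow> 'a::field_char_0) \<Rightarrow> (nat \<Rightarrow> 'a poly) \<Rightarrow> 'a mpoly vec" where
  "famn n a \<phi> = (let \<xi> = lin n a in
     vec n (\<lambda>i. if i < n - 1 then Var i + poly_at (\<phi> i) \<xi>
       else Var (n - 1) - (\<Sum>j<n - 1. Const (a j / a (n - 1)) * poly_at (\<phi> j) \<xi>)))"

end

(*
  The determinant det (1 + F) is the sum of all principal minors of F, the empty one being 1, which
  gives the first equivalence. Divergence-free fields in two and three variables get potentials by
  formal integration in one variable after another. A map x + s(xi) with xi = sum a_i x_i and
  sum a_i s_i = 0 fixes xi, so replacing s by -s inverts it, and its Jacobian matrix 1 + u v^T with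
  v.u = 0 is conjugate to a unitriangular matrix. With two linear forms, one is fixed by the map and
  the other is shifted by a polynomial in the fixed one. Restricting to a line gives the lower bounds
  for degrees.
*)

theory Submission
  imports Defs
begin

text \<open>All arguments are formal: polynomials are never treated as functions. Composition of
  maps and restriction to a line are therefore two instances of one evaluation homomorphism,
  \<open>meval\<close>, with different coefficient maps. The condition sum a_i s_i = 0 is imposed on
  the one-variable polynomials, because in that form it passes through both operations that matter:
  putting in the linear form gives its invariance, hence the inverse; differentiating first gives
  v.u = 0, hence the Jacobian. With two linear forms the Jacobian matrix is a rank-two perturbation
  of the identity, and its determinant differs from 1 by a multiple of (\<alpha> r - p)(b - \<beta>
  c) with \<alpha> = a/c, \<beta> = q/r. The two equalities on the parameters say that the first or
  the second factor is zero. The obstacle with degrees is cancellation. Against the variable itself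
  nothing cancels, as perturbations start in degree 2; on a suitable coordinate axis substitution
  becomes composition in one variable, where degrees multiply exactly. The bound d^2 is reached
  because the shifted form already contains a term of degree d and is then put into a polynomial of
  degree d.\<close>

section \<open>Evaluation, substitution and derivatives of polynomials\<close>

text \<open>A polynomial is the sum of its own terms. Since \<open>c\<close> may be 0, the case
  \<open>single\<close> also supplies the zero polynomial needed to start the sum.\<close>

lemma mpoly_induct [case_names single add]:
  fixes p :: "'a::comm_monoid_add mpoly"
  assumes single: "\<And>m c. P (Poly_Mapping.single m c)"
    and add: "\<And>p q. P p \<Longrightarrow> P q \<Longrightarrow> P (p + q)"
  shows "P p"
proof -
  let ?t = "\<lambda>m. Poly_Mapping.single m (Poly_Mapping.lookup p m)"
  have "P (\<Sum>m\<in>A. ?t m)" if "finite A" for A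
    using that
  proof induction
    case empty
    show ?case using single[of 0 0] by simp
  next
    case (insert x F)
    then show ?case using single add by simp
  qed
  moreover have "(\<Sum>m\<in>Poly_Mapping.keys p. ?t m) = p"
    by (rule poly_mapping_eqI)
      (simp add: lookup_sum lookup_single when_def in_keys_iff)
  ultimately show ?thesis by (metis finite_keys)
qed

lemma additive_eqI:
  fixes f g :: "'a::comm_monoid_add mpoly \<Rightarrow> 'b::plus"
  assumes "\<And>p q. f (p + q) = f p + f q" "\<And>p q. g (p + q) = g p + g q"
    and "\<And>m c. f (Poly_Mapping.single m c) = g (Poly_Mapping.single m c)"
  shows "f p = g p"
  by (induction p rule: mpoly_induct) (simp_all add: assms)

interpretation Const: comm_ring_hom Const
  by unfold_locales (simp_all add: Const_def single_add mult_single)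

definition monom_eval :: "(nat \<Rightarrow> 'b::comm_ring_1) \<Rightarrow> (nat \<Rightarrow>\<^sub>0 nat) \<Rightarrow> 'b" where
  "monom_eval q m = (\<Prod>i\<in>Poly_Mapping.keys m. q i ^ Poly_Mapping.lookup m i)"

lemma monom_eval_superset:
  assumes "finite S" "Poly_Mapping.keys m \<subseteq> S"
  shows "monom_eval q m = (\<Prod>i\<in>S. q i ^ Poly_Mapping.lookup m i)"
  unfolding monom_eval_def using assms by (intro prod.mono_neutral_left) (auto simp: in_keys_iff)

lemma monom_eval_zero [simp]: "monom_eval q 0 = 1"
  by (simp add: monom_eval_def)

lemma monom_eval_single [simp]: "monom_eval q (Poly_Mapping.single i k) = q i ^ k"
  by (simp add: monom_eval_def)

lemma monom_eval_add: "monom_eval q (m + n) = monom_eval q m * monom_eval q n"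
proof -
  let ?S = "Poly_Mapping.keys m \<union> Poly_Mapping.keys n"
  have "Poly_Mapping.keys (m + n) \<subseteq> ?S" by (rule keys_add)
  then show ?thesis
    by (simp add: monom_eval_superset[of ?S] lookup_add power_add prod.distrib)
qed

text \<open>The coefficient map is a parameter because two instances occur: \<open>Const\<close>,
  which gives \<open>psubst\<close>, and the embedding of scalars as constant one-variable
  polynomials, which restricts a polynomial to a line.\<close>

definition meval :: "('a::comm_ring_1 \<Rightarrow> 'b::comm_ring_1) \<Rightarrow> (nat \<Rightarrow> 'b) \<Rightarrow> 'a mpoly \<Rightarrow> 'b" where
  "meval h q p = (\<Sum>m\<in>Poly_Mapping.keys p. h (Poly_Mapping.lookup p m) * monom_eval q m)"

lemma psubst_eq_meval: "psubst q = meval Const q"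
  by (simp add: fun_eq_iff psubst_def meval_def monom_eval_def)

context comm_ring_hom
begin

lemma meval_add: "meval hom q (p + p') = meval hom q p + meval hom q p'"
  unfolding meval_def by (rule setsum_keys_plus_distrib) (simp_all add: hom_add algebra_simps)

lemma meval_single: "meval hom q (Poly_Mapping.single m c) = hom c * monom_eval q m"
  by (simp add: meval_def)

lemma meval_mult: "meval hom q (p * p') = meval hom q p * meval hom q p'"
proof (induction p rule: mpoly_induct)
  case (single m c)
  show ?case
    by (induction p' rule: mpoly_induct)
      (simp_all add: distrib_left meval_add mult_single meval_single hom_mult monom_eval_add)
next
  case (add p q)
  then show ?case by (simp add: distrib_right meval_add)
qed

lemma comm_ring_hom_meval: "comm_ring_hom (meval hom q)"
proof
  show "meval hom q 0 = 0" by (simp add: meval_def)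
  show "meval hom q 1 = 1" using meval_single[of q 0 1] by simp
qed (simp_all add: meval_add meval_mult)

lemma meval_Const [simp]: "meval hom q (Const c) = hom c"
  by (simp add: Const_def meval_single)

lemma meval_Var [simp]: "meval hom q (Var i) = q i"
  by (simp add: Var_def meval_single)

end

interpretation psubst: comm_ring_hom "psubst q"
  unfolding psubst_eq_meval by (rule Const.comm_ring_hom_meval)

lemma psubst_Const [simp]: "psubst q (Const c) = Const c"
  by (simp add: psubst_eq_meval)

lemma psubst_Var [simp]: "psubst q (Var i) = q i"
  by (simp add: psubst_eq_meval)

lemma psubst_single: "psubst q (Poly_Mapping.single m c) = Const c * monom_eval q m"
  by (simp add: psubst_eq_meval Const.meval_single)

lemma Var_power: "Var i ^ k = Poly_Mapping.single (Poly_Mapping.single i k) 1"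
proof (induction k)
  case (Suc k)
  then show ?case by (simp add: Var_def mult_single single_add[symmetric])
qed simp

lemma prod_single_one:
  "(\<Prod>i\<in>A. Poly_Mapping.single (f i) 1) = Poly_Mapping.single (\<Sum>i\<in>A. f i) (1::'a::comm_semiring_1)"
  for f :: "'b \<Rightarrow> 'c::comm_monoid_add"
  by (induction A rule: infinite_finite_induct) (simp_all add: mult_single)

lemma monom_eval_Var: "monom_eval Var m = Poly_Mapping.single m 1"
proof -
  have "monom_eval Var m = (\<Prod>i\<in>Poly_Mapping.keys m. Poly_Mapping.single (Poly_Mapping.single i (Poly_Mapping.lookup m i)) 1)"
    by (simp add: monom_eval_def Var_power)
  also have "\<dots> = Poly_Mapping.single (\<Sum>i\<in>Poly_Mapping.keys m. Poly_Mapping.single i (Poly_Mapping.lookup m i)) 1"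
    by (rule prod_single_one)
  also have "(\<Sum>i\<in>Poly_Mapping.keys m. Poly_Mapping.single i (Poly_Mapping.lookup m i)) = m"
    by (rule poly_mapping_eqI)
      (simp add: lookup_sum lookup_single when_def in_keys_iff)
  finally show ?thesis .
qed

lemma psubst_ident [simp]: "psubst Var p = p"
  by (rule additive_eqI[of "psubst Var" "\<lambda>p. p"])
    (simp_all add: psubst.hom_add psubst_single monom_eval_Var Const_def mult_single)

lemma psubst_psubst: "psubst q (psubst r p) = psubst (\<lambda>i. psubst q (r i)) p"
  by (rule additive_eqI[of "\<lambda>p. psubst q (psubst r p)"])
    (simp_all add: psubst_single monom_eval_def psubst.hom_add psubst.hom_mult psubst.hom_prod psubst.hom_power)

text \<open>This is where the condition on \<open>vars\<close> in \<open>poly_map\<close> takes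
  effect: a vector of dimension n is unspecified at indices from n on, and substitution must not see
  those entries.\<close>

lemma psubst_cong:
  assumes "vars p \<subseteq> V" "\<And>i. i \<in> V \<Longrightarrow> q i = r i"
  shows "psubst q p = psubst r p"
  unfolding psubst_def using assms by (intro sum.cong refl arg_cong2[of _ _ _ _ "(*)"] prod.cong)
    (auto simp: vars_def)

section \<open>Formal partial derivatives and antiderivatives\<close>

lemma pd_add: "pd i (p + q) = pd i p + pd i q"
  unfolding pd_def by (rule setsum_keys_plus_distrib) (simp_all add: single_add[symmetric] algebra_simps)

interpretation pd: additive "pd i"
  by unfold_locales (rule pd_add)

lemma pd_single:
  "pd i (Poly_Mapping.single m c) =
     Poly_Mapping.single (m - Poly_Mapping.single i 1) (of_nat (Poly_Mapping.lookup m i) * c)"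
  by (simp add: pd_def)

lemma pd_Const [simp]: "pd i (Const c) = 0"
  by (simp add: Const_def pd_single)

lemma pd_Var: "pd i (Var j) = (if i = j then 1 else 0)"
  by (simp add: Var_def pd_single lookup_single)

text \<open>Subtraction of exponents is truncated, so it commutes with addition only where the
  exponent is positive. In the uses below the other case carries the coefficient 0.\<close>

lemma minus_single_add_left:
  fixes m n :: "nat \<Rightarrow>\<^sub>0 nat"
  assumes "Poly_Mapping.lookup m i \<noteq> 0"
  shows "m + n - Poly_Mapping.single i 1 = (m - Poly_Mapping.single i 1) + n"
  by (rule poly_mapping_eqI) (use assms in \<open>auto simp: lookup_add lookup_minus lookup_single when_def\<close>)

lemma pd_mult: "pd i (p * q) = pd i p * q + p * pd i q"
proof (induction p rule: mpoly_induct)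
  case (single m c)
  show ?case
  proof (induction q rule: mpoly_induct)
    case (single n d)
    let ?e = "Poly_Mapping.single i (1::nat)"
    \<comment> \<open>If variable \<open>i\<close> does not occur in \<open>m\<close>, the exponents
      may differ, but both coefficients are 0.\<close>
    have left: "Poly_Mapping.single (m + n - ?e) (of_nat (Poly_Mapping.lookup m i) * (c * d)) =
          Poly_Mapping.single ((m - ?e) + n) (of_nat (Poly_Mapping.lookup m i) * (c * d))"
      using minus_single_add_left[of m i n] by (cases "Poly_Mapping.lookup m i = 0") simp_all
    have right: "Poly_Mapping.single (m + n - ?e) (of_nat (Poly_Mapping.lookup n i) * (c * d)) =
          Poly_Mapping.single (m + (n - ?e)) (of_nat (Poly_Mapping.lookup n i) * (c * d))"
      using minus_single_add_left[of n i m]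
      by (cases "Poly_Mapping.lookup n i = 0") (simp_all add: add.commute)
    have "pd i (Poly_Mapping.single m c * Poly_Mapping.single n d) =
        Poly_Mapping.single (m + n - ?e) (of_nat (Poly_Mapping.lookup m i) * (c * d)) +
        Poly_Mapping.single (m + n - ?e) (of_nat (Poly_Mapping.lookup n i) * (c * d))"
      by (simp add: mult_single pd_single lookup_add distrib_right single_add)
    also have "\<dots> = pd i (Poly_Mapping.single m c) * Poly_Mapping.single n d +
        Poly_Mapping.single m c * pd i (Poly_Mapping.single n d)"
      unfolding left right by (simp add: mult_single pd_single mult.assoc mult.left_commute)
    finally show ?case .
  next
    case (add p q)
    then show ?case by (simp add: distrib_left pd_add algebra_simps)
  qed
next
  case (add p q)
  then show ?case by (simp add: pd_add algebra_simps)
qed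

lemma pd_Const_mult: "pd i (Const c * p) = Const c * pd i p"
  by (simp add: pd_mult)

lemma pd_commute: "pd i (pd j p) = pd j (pd i p)"
proof (rule additive_eqI[of "\<lambda>p. pd i (pd j p)"])
  fix m :: "nat \<Rightarrow>\<^sub>0 nat" and c :: 'a
  show "pd i (pd j (Poly_Mapping.single m c)) = pd j (pd i (Poly_Mapping.single m c))"
    by (cases "i = j")
      (simp_all add: pd_single lookup_minus lookup_single mult_ac diff_diff_eq add_ac)
qed (simp_all add: pd_add)

text \<open>Termwise integration with integration constant 0. Division by the raised exponent is
  where characteristic zero enters the construction of potentials.\<close>

definition antideriv :: "nat \<Rightarrow> 'a::field_char_0 mpoly \<Rightarrow> 'a mpoly" where
  "antideriv i p = (\<Sum>m \<in> Poly_Mapping.keys p.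
     Poly_Mapping.single (m + Poly_Mapping.single i 1)
       (Poly_Mapping.lookup p m / of_nat (Suc (Poly_Mapping.lookup m i))))"

lemma antideriv_add: "antideriv i (p + q) = antideriv i p + antideriv i q"
  unfolding antideriv_def
  by (rule setsum_keys_plus_distrib) (simp_all add: single_add[symmetric] add_divide_distrib)

interpretation antideriv: additive "antideriv i"
  by unfold_locales (rule antideriv_add)

lemma antideriv_single:
  "antideriv i (Poly_Mapping.single m c) =
     Poly_Mapping.single (m + Poly_Mapping.single i 1) (c / of_nat (Suc (Poly_Mapping.lookup m i)))"
  by (simp add: antideriv_def)

lemma pd_antideriv [simp]: "pd i (antideriv i p) = p"
  by (rule additive_eqI[of "\<lambda>p. pd i (antideriv i p)"])
    (simp_all add: pd_add antideriv_add pd_single antideriv_single lookup_add del: of_nat_Suc)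

text \<open>Lowering the exponent of \<open>j\<close> leaves the exponent of \<open>i\<close>, and
  hence the divisor, unchanged.\<close>

lemma pd_antideriv_commute:
  assumes "i \<noteq> j"
  shows "pd j (antideriv i p) = antideriv i (pd j p)"
proof (rule additive_eqI[of "\<lambda>p. pd j (antideriv i p)"])
  fix m :: "nat \<Rightarrow>\<^sub>0 nat" and c :: 'a
  show "pd j (antideriv i (Poly_Mapping.single m c)) = antideriv i (pd j (Poly_Mapping.single m c))"
  proof (cases "Poly_Mapping.lookup m j = 0")
    case True
    then show ?thesis using assms
      by (simp add: pd_single antideriv_single lookup_add lookup_single lookup_minus antideriv.zero)
  next
    case False
    then show ?thesis using assms minus_single_add_left[of m j "Poly_Mapping.single i 1"]
      by (simp add: pd_single antideriv_single lookup_add lookup_single lookup_minus)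
  qed
qed (simp_all add: pd_add antideriv_add)

section \<open>Variables, orders and degrees\<close>

lemma in_keys_multE:
  assumes "m \<in> Poly_Mapping.keys (p * q)"
  obtains a b where "m = a + b" "a \<in> Poly_Mapping.keys p" "b \<in> Poly_Mapping.keys q"
  using assms keys_mult by blast

text \<open>Natural exponents cannot cancel, so the usual inclusion is an equality.\<close>

lemma keys_add_nat: "Poly_Mapping.keys (m + n) = Poly_Mapping.keys m \<union> Poly_Mapping.keys n"
  for m n :: "'b \<Rightarrow>\<^sub>0 nat"
  by (auto simp: in_keys_iff lookup_add)

lemma vars_zero [simp]: "vars 0 = {}"
  by (simp add: vars_def)

lemma vars_one [simp]: "vars (1 :: 'a::zero_neq_one mpoly) = {}"
  by (simp add: vars_def)

lemma vars_Const [simp]: "vars (Const c) = {}"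
  by (simp add: vars_def Const_def)

lemma vars_Var [simp]: "vars (Var i :: 'a::zero_neq_one mpoly) = {i}"
  by (simp add: vars_def Var_def)

lemma vars_uminus [simp]: "vars (- p) = vars p" for p :: "'a::ab_group_add mpoly"
  by (simp add: vars_def)

lemma vars_add: "vars (p + q) \<subseteq> vars p \<union> vars q"
  using keys_add[of p q] by (auto simp: vars_def)

lemma vars_minus: "vars (p - q) \<subseteq> vars p \<union> vars q" for p :: "'a::ab_group_add mpoly"
  using keys_diff[of p q] by (auto simp: vars_def)

lemma vars_mult: "vars (p * q) \<subseteq> vars p \<union> vars q"
  by (auto simp: vars_def keys_add_nat elim!: in_keys_multE)

lemma vars_sum: "vars (\<Sum>x\<in>A. f x) \<subseteq> (\<Union>x\<in>A. vars (f x))"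
  for f :: "'c \<Rightarrow> 'a::comm_monoid_add mpoly"
  by (auto simp: vars_def dest!: subsetD[OF keys_sum])

lemma vars_pd: "vars (pd i p) \<subseteq> vars p"
proof -
  have "Poly_Mapping.keys (pd i p) \<subseteq> (\<Union>m\<in>Poly_Mapping.keys p. {m - Poly_Mapping.single i 1})"
    unfolding pd_def by (rule order.trans[OF keys_sum]) (rule UN_mono, auto split: if_splits)
  moreover have "Poly_Mapping.keys (m - n) \<subseteq> Poly_Mapping.keys m" for m n :: "nat \<Rightarrow>\<^sub>0 nat"
    by (auto simp: in_keys_iff lookup_minus)
  ultimately show ?thesis
    unfolding vars_def by blast
qed

lemma vars_antideriv: "vars (antideriv i p) \<subseteq> insert i (vars p)"
proof -
  have "Poly_Mapping.keys (antideriv i p) \<subseteq> (\<Union>m\<in>Poly_Mapping.keys p. {m + Poly_Mapping.single i 1})"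
    unfolding antideriv_def by (rule order.trans[OF keys_sum]) (rule UN_mono, auto split: if_splits)
  then show ?thesis
    by (auto simp: vars_def keys_add_nat dest!: subsetD)
qed

lemma mdeg_superset:
  assumes "finite S" "Poly_Mapping.keys m \<subseteq> S"
  shows "mdeg m = (\<Sum>i\<in>S. Poly_Mapping.lookup m i)"
  unfolding mdeg_def using assms by (intro sum.mono_neutral_left) (auto simp: in_keys_iff)

lemma mdeg_zero [simp]: "mdeg 0 = 0"
  by (simp add: mdeg_def)

lemma mdeg_single [simp]: "mdeg (Poly_Mapping.single i k) = k"
  by (simp add: mdeg_def)

lemma mdeg_add: "mdeg (m + n) = mdeg m + mdeg n"
proof -
  let ?S = "Poly_Mapping.keys m \<union> Poly_Mapping.keys n"
  show ?thesis
    by (simp add: mdeg_superset[of ?S] keys_add_nat lookup_add sum.distrib)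
qed

lemma terms_ge_zero [simp]: "terms_ge k 0"
  by (simp add: terms_ge_def)

lemma terms_ge_0 [simp]: "terms_ge 0 p"
  by (simp add: terms_ge_def)

lemma terms_ge_Var [simp]: "terms_ge k (Var i :: 'a::zero_neq_one mpoly) \<longleftrightarrow> k \<le> 1"
  by (simp add: terms_ge_def Var_def)

lemma terms_ge_uminus [simp]: "terms_ge k (- p) \<longleftrightarrow> terms_ge k p" for p :: "'a::ab_group_add mpoly"
  by (simp add: terms_ge_def)

lemma terms_ge_minus: "terms_ge k p \<Longrightarrow> terms_ge k q \<Longrightarrow> terms_ge k (p - q)"
  for p q :: "'a::ab_group_add mpoly"
  using keys_diff[of p q] by (auto simp: terms_ge_def)

lemma terms_ge_sum: "(\<And>x. x \<in> A \<Longrightarrow> terms_ge k (f x)) \<Longrightarrow> terms_ge k (\<Sum>x\<in>A. f x)"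
  for f :: "'c \<Rightarrow> 'a::comm_monoid_add mpoly"
  by (auto simp: terms_ge_def dest!: subsetD[OF keys_sum])

lemma terms_ge_mult: "terms_ge j p \<Longrightarrow> terms_ge k q \<Longrightarrow> terms_ge (j + k) (p * q)"
  by (auto simp: terms_ge_def mdeg_add elim!: in_keys_multE intro!: add_mono)

lemma terms_ge_mult_left: "terms_ge k q \<Longrightarrow> terms_ge k (p * q)"
  using terms_ge_mult[of 0 p k q] by simp

lemma terms_ge_power: "terms_ge 1 p \<Longrightarrow> terms_ge k (p ^ k)"
proof (induction k)
  case (Suc k)
  then show ?case using terms_ge_mult[of 1 p k "p ^ k"] by simp
qed simp

lemma terms_ge_mono: "terms_ge k p \<Longrightarrow> j \<le> k \<Longrightarrow> terms_ge j p"
  by (auto simp: terms_ge_def)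

lemma total_degree_le_iff: "total_degree p \<le> k \<longleftrightarrow> (\<forall>m\<in>Poly_Mapping.keys p. mdeg m \<le> k)"
  by (auto simp: total_degree_def)

lemma mdeg_le_total_degree: "m \<in> Poly_Mapping.keys p \<Longrightarrow> mdeg m \<le> total_degree p"
  using total_degree_le_iff[of p "total_degree p"] by simp

lemma total_degree_Const [simp]: "total_degree (Const c) = 0"
  by (simp add: total_degree_def Const_def)

lemma total_degree_one [simp]: "total_degree (1 :: 'a::zero_neq_one mpoly) = 0"
  by (simp add: total_degree_def)

lemma total_degree_Var [simp]: "total_degree (Var i :: 'a::zero_neq_one mpoly) = 1"
  by (simp add: total_degree_def Var_def)

lemma total_degree_add_le: "total_degree p \<le> k \<Longrightarrow> total_degree q \<le> k \<Longrightarrow> total_degree (p + q) \<le> k"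
  using keys_add[of p q] by (auto simp: total_degree_le_iff)

lemma total_degree_minus_le: "total_degree p \<le> k \<Longrightarrow> total_degree q \<le> k \<Longrightarrow> total_degree (p - q) \<le> k"
  for p q :: "'a::ab_group_add mpoly"
  using keys_diff[of p q] by (auto simp: total_degree_le_iff)

lemma total_degree_sum_le: "(\<And>x. x \<in> A \<Longrightarrow> total_degree (f x) \<le> k) \<Longrightarrow> total_degree (\<Sum>x\<in>A. f x) \<le> k"
  for f :: "'c \<Rightarrow> 'a::comm_monoid_add mpoly"
  by (auto simp: total_degree_le_iff dest!: subsetD[OF keys_sum])

lemma total_degree_mult_le:
  "total_degree p \<le> j \<Longrightarrow> total_degree q \<le> k \<Longrightarrow> total_degree (p * q) \<le> j + k"
  by (auto simp: total_degree_le_iff mdeg_add elim!: in_keys_multE intro!: add_mono)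

lemma total_degree_Const_mult_le: "total_degree p \<le> k \<Longrightarrow> total_degree (Const c * p) \<le> k"
  using total_degree_mult_le[of "Const c" 0 p k] by simp

lemma total_degree_power_le: "total_degree p \<le> j \<Longrightarrow> total_degree (p ^ k) \<le> k * j"
proof (induction k)
  case 0
  then show ?case by simp
next
  case (Suc k)
  then show ?case using total_degree_mult_le[of p j "p ^ k" "k * j"] by simp
qed

text \<open>\<open>s\<close> has no linear term, so \<open>Var i\<close> survives in the sum. The
  maximum with 1 matters only for \<open>s = 0\<close>. In particular the degree does not change
  when \<open>s\<close> is replaced by \<open>- s\<close>.\<close>

lemma total_degree_Var_add:
  assumes "terms_ge 2 s"
  shows "total_degree (Var i + s) = max 1 (total_degree s)"
proof -
  have "Poly_Mapping.keys (Var i + s) = insert (Poly_Mapping.single i 1) (Poly_Mapping.keys s)"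
  proof -
    have "Poly_Mapping.lookup s (Poly_Mapping.single i 1) = 0"
      using assms by (auto simp: terms_ge_def in_keys_iff dest: bspec[of _ _ "Poly_Mapping.single i 1"])
    then show ?thesis
      by (auto simp: in_keys_iff lookup_add Var_def lookup_single when_def split: if_splits)
  qed
  then show ?thesis
    by (cases "Poly_Mapping.keys s = {}") (simp_all add: total_degree_def insert_commute[of 0 1])
qed

lemma total_degree_uminus [simp]: "total_degree (- p) = total_degree p"
  for p :: "'a::ab_group_add mpoly"
  by (simp add: total_degree_def)

section \<open>One-variable polynomials evaluated at polynomials in several variables\<close>

lemma poly_at_zero [simp]: "poly_at 0 p = 0"
  by (simp add: poly_at_def)

lemma poly_at_pCons: "poly_at (pCons a s) p = Const a + p * poly_at s p"
  by (cases "a = 0 \<and> s = 0") (auto simp: poly_at_def map_poly_pCons)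

lemma poly_at_add: "poly_at (s + t) p = poly_at s p + poly_at t p"
proof -
  have "map_poly Const (s + t) = map_poly Const s + map_poly Const t"
    by (rule poly_eqI) (simp add: coeff_map_poly Const.hom_add)
  then show ?thesis by (simp add: poly_at_def)
qed

lemma poly_at_altdef: "poly_at s p = (\<Sum>i\<le>Polynomial.degree s. Const (coeff s i) * p ^ i)"
proof (induction s)
  case (pCons a s)
  show ?case
  proof (cases "s = 0")
    case False
    then show ?thesis
      by (simp add: poly_at_pCons pCons.IH sum.atMost_Suc_shift sum_distrib_left mult_ac del: sum.atMost_Suc)
  qed (simp add: poly_at_pCons)
qed simp

lemma pderiv_chain: "pd i (poly_at s p) = poly_at (pderiv s) p * pd i p"
proof (induction s)
  case (pCons a s)
  show ?case
    by (simp add: poly_at_pCons pd_add pd_mult pCons.IH pderiv_pCons poly_at_add algebra_simps)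
qed (simp add: pd.zero)

lemma (in comm_ring_hom) meval_poly_at:
  "meval hom q (poly_at s p) = poly (map_poly hom s) (meval hom q p)"
proof -
  interpret m: comm_ring_hom "meval hom q" by (rule comm_ring_hom_meval)
  show ?thesis
  proof (induction s)
    case (pCons a s)
    then show ?case
      by (simp add: poly_at_pCons m.hom_add m.hom_mult map_poly_pCons)
  qed simp
qed

lemma psubst_poly_at: "psubst q (poly_at s p) = poly_at s (psubst q p)"
  by (simp only: psubst_eq_meval Const.meval_poly_at) (simp add: poly_at_def)

lemma vars_poly_at: "vars (poly_at s p) \<subseteq> vars p"
proof (induction s)
  case (pCons a s)
  then show ?case
    using vars_mult[of p "poly_at s p"] vars_add[of "Const a" "p * poly_at s p"]
    by (auto simp: poly_at_pCons)
qed simp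

text \<open>Powers below \<open>k\<close> have coefficient 0; the other powers have order at least
  \<open>k\<close> because \<open>p\<close> has no constant term.\<close>

lemma terms_ge_poly_at:
  assumes "uterms_ge k s" "terms_ge 1 p"
  shows "terms_ge k (poly_at s p)"
  unfolding poly_at_altdef
proof (intro terms_ge_sum)
  fix i
  show "terms_ge k (Const (coeff s i) * p ^ i)"
  proof (cases "i < k")
    case True
    then show ?thesis using assms by (simp add: uterms_ge_def)
  next
    case False
    then show ?thesis
      using terms_ge_power[OF assms(2), of i] by (intro terms_ge_mult_left) (auto intro: terms_ge_mono)
  qed
qed

lemma uterms_ge_pderiv: "uterms_ge (Suc k) s \<Longrightarrow> uterms_ge k (pderiv s)"
  by (simp add: uterms_ge_def coeff_pderiv)

lemma total_degree_poly_at_le: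
  assumes "total_degree p \<le> k"
  shows "total_degree (poly_at s p) \<le> Polynomial.degree s * k"
  unfolding poly_at_altdef
proof (intro total_degree_sum_le total_degree_Const_mult_le)
  fix i assume "i \<in> {..Polynomial.degree s}"
  then show "total_degree (p ^ i) \<le> Polynomial.degree s * k"
    using total_degree_power_le[OF assms, of i] by (meson atMost_iff le_trans mult_le_mono1)
qed

text \<open>Restricting a polynomial to a parametrised line bounds its total degree from below.\<close>

lemma degree_meval_le:
  fixes q :: "nat \<Rightarrow> 'a::comm_ring_1 poly"
  assumes "\<And>i. Polynomial.degree (q i) \<le> 1"
  shows "Polynomial.degree (meval (\<lambda>c. [:c:]) q p) \<le> total_degree p"
  unfolding meval_def
proof (intro degree_sum_le finite_keys)
  fix m assume "m \<in> Poly_Mapping.keys p"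
  have "Polynomial.degree (monom_eval q m) \<le> (\<Sum>i\<in>Poly_Mapping.keys m. Polynomial.degree (q i ^ Poly_Mapping.lookup m i))"
    unfolding monom_eval_def by (rule degree_prod_sum_le[unfolded o_def]) simp
  also have "\<dots> \<le> mdeg m"
    unfolding mdeg_def
  proof (rule sum_mono)
    fix i
    have "Polynomial.degree (q i ^ Poly_Mapping.lookup m i) \<le> Polynomial.degree (q i) * Poly_Mapping.lookup m i"
      by (rule degree_power_le)
    also have "\<dots> \<le> 1 * Poly_Mapping.lookup m i" using assms by (rule mult_le_mono1)
    finally show "Polynomial.degree (q i ^ Poly_Mapping.lookup m i) \<le> Poly_Mapping.lookup m i" by simp
  qed
  also have "\<dots> \<le> total_degree p" using \<open>m \<in> _\<close> by (rule mdeg_le_total_degree)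
  finally show "Polynomial.degree ([:Poly_Mapping.lookup p m:] * monom_eval q m) \<le> total_degree p"
    using degree_smult_le[of "Poly_Mapping.lookup p m" "monom_eval q m"] by simp
qed

lemma comm_ring_hom_const_poly: "comm_ring_hom (\<lambda>c::'a::comm_ring_1. [:c:])"
  by unfold_locales (simp_all add: one_pCons)

text \<open>On a line, \<open>poly_at\<close> becomes composition of one-variable polynomials. Exact
  degrees then follow from \<open>degree_pcompose\<close>, without any study of leading
  forms.\<close>

lemma meval_poly_at_pcompose:
  "meval (\<lambda>c. [:c:]) q (poly_at s p) = pcompose s (meval (\<lambda>c. [:c:]) q p)"
  by (simp add: comm_ring_hom.meval_poly_at[OF comm_ring_hom_const_poly] pcompose_altdef)

section \<open>Determinants\<close>

text \<open>Transporting permutations along the increasing enumeration \<open>pick I\<close>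
  preserves signs. Minors indexed by different \<open>I\<close> thus become sums over permutations
  of one common index set, as the expansion of \<open>det (1 + A)\<close> requires.\<close>

lemma det_submatrix_diag:
  fixes A :: "'a::comm_ring_1 mat"
  assumes A: "A \<in> carrier_mat n n" and I: "I \<subseteq> {..<n}"
  shows "det (submatrix A I I) = (\<Sum>p | p permutes I. signof p * (\<Prod>i\<in>I. A $$ (i, p i)))"
proof -
  let ?k = "card I" and ?f = "pick I"
  let ?T = "\<lambda>p. map_permutation {0..<?k} ?f p"
  have finI: "finite I" using I finite_subset by blast
  have dims: "{i. i < dim_row A \<and> i \<in> I} = I" "{j. j < dim_col A \<and> j \<in> I} = I"
    using A I by auto
  have "inj_on ?f {0..<?k}"
    by (rule inj_onI) (metis card_pick_le atLeastLessThan_iff)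
  moreover have "?f ` {0..<?k} = I"
    by (rule card_subset_eq[OF finI]) (use calculation in \<open>auto simp: pick_in_set_le card_image\<close>)
  ultimately have f: "bij_betw ?f {0..<?k} I" by (simp add: bij_betw_def)
  note inj = bij_betw_imp_inj_on[OF f]
  define g where "g = inv_into {0..<?k} ?f"
  have gf: "g (?f x) = x" if "x \<in> {0..<?k}" for x
    unfolding g_def using inj that by (rule inv_into_f_f)
  have fg: "?f (g y) = y" if "y \<in> I" for y
    unfolding g_def using f that by (metis bij_betw_def f_inv_into_f)
  have g: "bij_betw g I {0..<?k}"
    unfolding g_def using f by (rule bij_betw_inv_into)
  have S: "submatrix A I I \<in> carrier_mat ?k ?k"
    by (rule carrier_matI) (simp_all only: dim_submatrix dims)
  have "det (submatrix A I I) =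
      (\<Sum>p | p permutes {0..<?k}. signof p * (\<Prod>i = 0..<?k. submatrix A I I $$ (i, p i)))"
    by (rule det_def'[OF S])
  also have "\<dots> = (\<Sum>p | p permutes I. signof p * (\<Prod>i\<in>I. A $$ (i, p i)))"
  proof (rule sum.reindex_bij_witness[where j = ?T and i = "map_permutation I g"])
    fix p assume p: "p \<in> {p. p permutes {0..<?k}}"
    show "map_permutation I g (?T p) = p"
      by (rule map_permutation_compose_inv[OF f]) (use p gf in auto)
    show "?T p \<in> {p. p permutes I}"
      using p f by (simp add: map_permutation_permutes)
    have "(\<Prod>i\<in>I. A $$ (i, ?T p i)) = (\<Prod>i = 0..<?k. A $$ (?f i, ?T p (?f i)))"
      by (rule prod.reindex_bij_betw[OF f, symmetric])
    also have "\<dots> = (\<Prod>i = 0..<?k. submatrix A I I $$ (i, p i))"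
    proof (rule prod.cong[OF refl])
      fix i assume i: "i \<in> {0..<?k}"
      then have "p i < ?k" using p permutes_in_image[of p "{0..<?k}" i] by auto
      with i show "A $$ (?f i, ?T p (?f i)) = submatrix A I I $$ (i, p i)"
        using inj by (simp add: map_permutation_apply submatrix_index dims)
    qed
    finally show "signof (?T p) * (\<Prod>i\<in>I. A $$ (i, ?T p i)) =
        signof p * (\<Prod>i = 0..<?k. submatrix A I I $$ (i, p i))"
      using p inj by (simp add: sign_map_permutation)
  next
    fix p assume p: "p \<in> {p. p permutes I}"
    show "?T (map_permutation I g p) = p"
      by (rule map_permutation_compose_inv[OF g]) (use p fg in auto)
    show "map_permutation I g p \<in> {p. p permutes {0..<?k}}"
      using p g by (simp add: map_permutation_permutes)
  qed
  finally show ?thesis .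
qed

text \<open>Each Leibniz product of entries A + \<delta> is multiplied out over the set
  \<open>I\<close> of positions where A is chosen. The remaining product of \<delta>'s is 1 exactly
  when \<open>p\<close> fixes everything outside \<open>I\<close>, that is, when \<open>p\<close>
  permutes \<open>I\<close>. Exchanging the two sums leaves the Leibniz formula of each principal
  minor.\<close>

lemma det_one_add:
  fixes A :: "'a::comm_ring_1 mat"
  assumes A: "A \<in> carrier_mat n n"
  shows "det (1\<^sub>m n + A) = (\<Sum>I\<in>Pow {..<n}. det (submatrix A I I))"
proof -
  let ?N = "{0..<n}"
  let ?d = "\<lambda>i j. if i = j then 1 else (0::'a)"
  have del: "(\<Prod>i\<in>?N - I. ?d i (p i)) = (if p permutes I then 1 else 0)"
    if "p permutes ?N" "I \<subseteq> ?N" for p I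
  proof (cases "\<forall>i\<in>?N - I. p i = i")
    case True
    then have "p permutes I" using that permutes_superset by blast
    with True show ?thesis by simp
  next
    case False
    then obtain i where i: "i \<in> ?N - I" "p i \<noteq> i" by blast
    then have "\<not> p permutes I" by (auto simp: permutes_def)
    moreover have "(\<Prod>i\<in>?N - I. ?d i (p i)) = 0"
      using i by (intro prod_zero bexI[of _ i]) auto
    ultimately show ?thesis by simp
  qed
  have "det (1\<^sub>m n + A) =
      (\<Sum>p | p permutes ?N. signof p * (\<Prod>i\<in>?N. A $$ (i, p i) + ?d i (p i)))"
  proof -
    have "1\<^sub>m n + A \<in> carrier_mat n n" using A by simp
    moreover have "(\<Prod>i = 0..<n. (1\<^sub>m n + A) $$ (i, p i)) = (\<Prod>i\<in>?N. A $$ (i, p i) + ?d i (p i))"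
      if "p permutes ?N" for p
    proof (rule prod.cong[OF refl])
      fix i assume i: "i \<in> ?N"
      then have "p i < n" using that permutes_in_image[of p ?N i] by auto
      with i A show "(1\<^sub>m n + A) $$ (i, p i) = A $$ (i, p i) + ?d i (p i)" by auto
    qed
    ultimately show ?thesis by (simp add: det_def')
  qed
  also have "\<dots> = (\<Sum>p | p permutes ?N. \<Sum>I\<in>Pow ?N.
      if p permutes I then signof p * (\<Prod>i\<in>I. A $$ (i, p i)) else 0)"
  proof (rule sum.cong[OF refl])
    fix p assume "p \<in> {p. p permutes ?N}"
    then have "(\<Prod>i\<in>?N. A $$ (i, p i) + ?d i (p i)) =
        (\<Sum>I\<in>Pow ?N. (\<Prod>i\<in>I. A $$ (i, p i)) * (if p permutes I then 1 else 0))"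
      by (subst prod_add, simp) (intro sum.cong arg_cong2[of _ _ _ _ "(*)"] refl del, auto)
    then show "signof p * (\<Prod>i\<in>?N. A $$ (i, p i) + ?d i (p i)) =
        (\<Sum>I\<in>Pow ?N. if p permutes I then signof p * (\<Prod>i\<in>I. A $$ (i, p i)) else 0)"
      by (simp only: sum_distrib_left) (intro sum.cong refl, simp)
  qed
  also have "\<dots> = (\<Sum>I\<in>Pow ?N. \<Sum>p | p permutes ?N.
      if p permutes I then signof p * (\<Prod>i\<in>I. A $$ (i, p i)) else 0)"
    by (rule sum.swap)
  also have "\<dots> = (\<Sum>I\<in>Pow ?N. \<Sum>p | p permutes I. signof p * (\<Prod>i\<in>I. A $$ (i, p i)))"
  proof (rule sum.cong[OF refl])
    fix I assume "I \<in> Pow ?N"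
    then have eq: "{p \<in> {p. p permutes ?N}. p permutes I} = {p. p permutes I}"
      using permutes_subset by blast
    show "(\<Sum>p | p permutes ?N. if p permutes I then signof p * (\<Prod>i\<in>I. A $$ (i, p i)) else 0) =
        (\<Sum>p | p permutes I. signof p * (\<Prod>i\<in>I. A $$ (i, p i)))"
      by (simp add: sum.inter_filter[symmetric] finite_permutations flip: eq)
  qed
  also have "\<dots> = (\<Sum>I\<in>Pow {..<n}. det (submatrix A I I))"
    by (intro sum.cong) (auto simp: det_submatrix_diag[OF A] lessThan_atLeast0)
  finally show ?thesis .
qed

lemma det_one_add_minor_sums:
  fixes A :: "'a::comm_ring_1 mat"
  assumes A: "A \<in> carrier_mat n n"
  shows "det (1\<^sub>m n + A) = 1 + (\<Sum>k=1..n. E k A)"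
proof -
  have dim: "dim_row A = n" using A by simp
  have E0: "E 0 A = 1"
  proof -
    have "{I. I \<subseteq> {..<n} \<and> card I = 0} = {{}}"
      by auto (metis card_0_eq empty_iff finite_lessThan finite_subset)
    moreover have "submatrix A {} {} \<in> carrier_mat 0 0"
      by (rule carrier_matI) (simp_all add: dim_submatrix)
    ultimately show ?thesis by (simp add: E_def dim)
  qed
  have "det (1\<^sub>m n + A) = (\<Sum>I\<in>Pow {..<n}. det (submatrix A I I))"
    by (rule det_one_add[OF A])
  also have "\<dots> = (\<Sum>k\<in>{0..n}. \<Sum>I\<in>{I\<in>Pow {..<n}. card I = k}. det (submatrix A I I))"
    by (rule sum.group[symmetric]) (auto dest: card_mono[rotated])
  also have "\<dots> = (\<Sum>k=0..n. E k A)"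
    by (intro sum.cong) (auto simp: E_def dim)
  also have "\<dots> = 1 + (\<Sum>k=1..n. E k A)"
    by (simp add: sum.atLeast_Suc_atMost E0)
  finally show ?thesis .
qed

lemma det_mat_1: "det (mat (Suc 0) (Suc 0) g) = g (0, 0)"
  by (subst det_single) simp_all

lemma det_2:
  assumes "A \<in> carrier_mat 2 2"
  shows "det A = A $$ (0,0) * A $$ (1,1) - A $$ (0,1) * A $$ (1,0)"
  using assms
  by (subst laplace_expansion_row[OF assms, of 0])
    (simp_all add: numeral_2_eq_2 cofactor_def det_mat_1 mat_delete_def)

lemma det_3:
  assumes "A \<in> carrier_mat 3 3"
  shows "det A =
      A $$ (0,0) * (A $$ (1,1) * A $$ (2,2) - A $$ (1,2) * A $$ (2,1))
    - A $$ (0,1) * (A $$ (1,0) * A $$ (2,2) - A $$ (1,2) * A $$ (2,0))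
    + A $$ (0,2) * (A $$ (1,0) * A $$ (2,1) - A $$ (1,1) * A $$ (2,0))"
proof -
  \<comment> \<open>\<open>det_2\<close> with the dimension in successor form, as the cofactor
    expansion produces it.\<close>
  have d2: "det (mat (Suc (Suc 0)) (Suc (Suc 0)) g) = g (0,0) * g (1,1) - g (0,1) * g (1,0)"
    for g :: "nat \<times> nat \<Rightarrow> 'a"
    using det_2[of "mat 2 2 g"] by (simp add: numeral_2_eq_2)
  show ?thesis
    using assms
    by (subst laplace_expansion_row[OF assms, of 0])
      (simp_all add: numeral_3_eq_3 numeral_2_eq_2 cofactor_def mat_delete_def d2 algebra_simps)
qed

text \<open>Conjugating by the matrix \<open>L\<close>, the identity with last row \<open>v\<close>, turns \<open>1 + u v\<^sup>T\<close> into an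
  upper unitriangular matrix.\<close>

lemma det_one_add_rank_one:
  fixes u v :: "nat \<Rightarrow> 'a::idom"
  assumes orth: "(\<Sum>i<Suc n. v i * u i) = 0" and v: "v n \<noteq> 0"
  shows "det (mat (Suc n) (Suc n) (\<lambda>(i, j). (if i = j then 1 else 0) + u i * v j)) = 1"
proof -
  let ?M = "mat (Suc n) (Suc n) (\<lambda>(i, j). (if i = j then 1 else 0) + u i * v j)"
  let ?L = "mat (Suc n) (Suc n) (\<lambda>(i, j). if i = n then v j else if i = j then 1 else 0)"
  let ?U = "mat (Suc n) (Suc n) (\<lambda>(i, j). if i = j then 1 else if j = n then u i else 0)"
  have carr: "?M \<in> carrier_mat (Suc n) (Suc n)" "?L \<in> carrier_mat (Suc n) (Suc n)"
    "?U \<in> carrier_mat (Suc n) (Suc n)" by simp_all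
  \<comment> \<open>Conjugation is written as an intertwining relation, since over an integral
    domain \<open>?L\<close> need not be invertible: its determinant \<open>v n\<close> is only
    known to be nonzero. It is cancelled at the end.\<close>
  have "?L * ?M = ?U * ?L"
  proof (rule eq_matI)
    fix i j assume "i < dim_row (?U * ?L)" "j < dim_col (?U * ?L)"
    then have ij: "i < Suc n" "j < Suc n" by simp_all
    have "(?L * ?M) $$ (i, j) =
        (\<Sum>k<Suc n. (if i = n then v k else if i = k then 1 else 0) * ((if k = j then 1 else 0) + u k * v j))"
      using ij by (simp add: scalar_prod_def lessThan_atLeast0)
    \<comment> \<open>Row \<open>n\<close> of the product is v^T (1 + u v^T), which orthogonality
      reduces to v^T; the other rows of \<open>?L\<close> merely copy rows of
      \<open>?M\<close>.\<close>
    also have "\<dots> = (if i = n then v j else (if i = j then 1 else 0) + u i * v j)"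
    proof (cases "i = n")
      case True
      have "(\<Sum>k<Suc n. v k * ((if k = j then 1 else 0) + u k * v j)) =
          (\<Sum>k<Suc n. if k = j then v k else 0) + (\<Sum>k<Suc n. v k * u k) * v j"
        unfolding sum_distrib_right sum.distrib[symmetric]
        by (intro sum.cong) (auto simp: algebra_simps)
      then show ?thesis using True ij orth by (simp del: sum.lessThan_Suc)
    next
      case False
      have "(\<Sum>k<Suc n. (if i = k then 1 else 0) * ((if k = j then 1 else 0) + u k * v j)) =
          (\<Sum>k<Suc n. if i = k then (if k = j then 1 else 0) + u k * v j else 0)"
        by (intro sum.cong) auto
      then show ?thesis using False ij by (simp del: sum.lessThan_Suc)
    qed
    also have "\<dots> = (\<Sum>k<Suc n. (if i = k then 1 else if k = n then u i else 0) * (if k = n then v j else if k = j then 1 else 0))"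
    proof -
      have "(\<Sum>k<n. (if i = k then 1 else if k = n then u i else 0) * (if k = n then v j else if k = j then 1 else 0)) =
         (\<Sum>k<n. if i = k then (if k = j then 1 else 0) else 0)"
        by (intro sum.cong) auto
      then show ?thesis using ij by auto
    qed
    also have "\<dots> = (?U * ?L) $$ (i, j)"
      using ij by (simp add: scalar_prod_def lessThan_atLeast0)
    finally show "(?L * ?M) $$ (i, j) = (?U * ?L) $$ (i, j)" .
  qed simp_all
  then have "det ?L * det ?M = det ?U * det ?L"
    by (metis det_mult[OF carr(2,1)] det_mult[OF carr(3,2)])
  moreover have "det ?U = 1"
    by (subst det_upper_triangular[OF _ carr(3)]) (auto simp: prod_list_diag_prod)
  moreover have "det ?L = v n"
    by (subst det_lower_triangular[OF _ carr(2)]) (auto simp: prod_list_diag_prod)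
  ultimately show ?thesis using v by simp
qed

section \<open>Polynomial maps and shears\<close>

lemma poly_at_smult: "poly_at (smult c s) p = Const c * poly_at s p"
  by (induction s) (simp_all add: poly_at_pCons Const.hom_mult algebra_simps)

lemma poly_at_uminus: "poly_at (- s) p = - poly_at s p"
  using poly_at_smult[of "- 1" s p] by (simp add: Const.hom_uminus)

lemma poly_at_sum: "poly_at (\<Sum>x\<in>A. f x) p = (\<Sum>x\<in>A. poly_at (f x) p)"
  by (induction A rule: infinite_finite_induct) (simp_all add: poly_at_add)

lemma Const_eq_0_iff [simp]: "Const c = 0 \<longleftrightarrow> c = 0"
  by (auto simp: Const_def dest: arg_cong[where f = "\<lambda>p. Poly_Mapping.lookup p 0"])

lemma vars_lin: "vars (lin n a) \<subseteq> {..<n}"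
proof -
  have "vars (Const (a i) * Var i) \<subseteq> {..<n}" if "i < n" for i
    using vars_mult[of "Const (a i)" "Var i"] that by auto
  then show ?thesis
    unfolding lin_def by (intro order.trans[OF vars_sum] UN_least) simp
qed

lemma vars_poly_at_lin: "vars (poly_at s (lin n a)) \<subseteq> {..<n}"
  by (rule order.trans[OF vars_poly_at vars_lin])

lemma terms_ge_lin: "terms_ge 1 (lin n a)"
  unfolding lin_def by (intro terms_ge_sum terms_ge_mult_left) simp

lemma total_degree_lin_le: "total_degree (lin n a) \<le> 1"
  unfolding lin_def by (intro total_degree_sum_le total_degree_Const_mult_le) simp

lemma pd_lin: "j < n \<Longrightarrow> pd j (lin n a) = Const (a j)"
  by (simp add: lin_def pd.sum pd_Const_mult pd_Var if_distrib[of "(*) _"] cong: if_cong)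

lemma psubst_lin: "psubst q (lin n a) = (\<Sum>i<n. Const (a i) * q i)"
  by (simp add: lin_def psubst.hom_sum psubst.hom_mult)

section \<open>Composition, uniqueness of inverses, and degrees of polynomial maps\<close>

lemma pm_comp_index: "i < dim_vec P \<Longrightarrow> pm_comp P Q $ i = psubst (\<lambda>j. Q $ j) (P $ i)"
  by (simp add: pm_comp_def)

lemma poly_map_carrier: "poly_map n P \<Longrightarrow> P \<in> carrier_vec n"
  by (simp add: poly_map_def)

text \<open>The two sides substitute families that agree only at indices below \<open>n\<close>; the
  components of \<open>R\<close> contain no other variables.\<close>

lemma pm_comp_assoc:
  assumes "poly_map n R" "P \<in> carrier_vec n"
  shows "pm_comp (pm_comp R P) Q = pm_comp R (pm_comp P Q)"
proof (rule eq_vecI)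
  fix i assume "i < dim_vec (pm_comp R (pm_comp P Q))"
  then have "i < dim_vec R" by (simp add: pm_comp_def)
  moreover from this assms have "vars (R $ i) \<subseteq> {..<n}" by (auto simp: poly_map_def)
  then have "psubst (\<lambda>j. psubst (\<lambda>k. Q $ k) (P $ j)) (R $ i) = psubst (\<lambda>j. pm_comp P Q $ j) (R $ i)"
    using assms(2) by (intro psubst_cong[of _ "{..<n}"]) (auto simp: pm_comp_index)
  ultimately show "pm_comp (pm_comp R P) Q $ i = pm_comp R (pm_comp P Q) $ i"
    by (simp add: pm_comp_def psubst_psubst)
qed (simp add: pm_comp_def)

lemma pm_comp_id_right:
  assumes "poly_map n P"
  shows "pm_comp P (pm_id n) = P"
proof (rule eq_vecI)
  fix i assume i: "i < dim_vec P"
  then have "vars (P $ i) \<subseteq> {..<n}" using assms by (auto simp: poly_map_def)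
  then have "psubst (\<lambda>j. pm_id n $ j) (P $ i) = psubst Var (P $ i)"
    by (intro psubst_cong) (auto simp: pm_id_def)
  then show "pm_comp P (pm_id n) $ i = P $ i" using i by (simp add: pm_comp_index)
qed (simp add: pm_comp_def)

lemma pm_comp_id_left: "P \<in> carrier_vec n \<Longrightarrow> pm_comp (pm_id n) P = P"
  by (rule eq_vecI) (simp_all add: pm_comp_def pm_id_def)

text \<open>Two inverses agree by Q' = Q' (P Q) = (Q' P) Q = Q, so the definite description in
  \<open>pm_inv\<close> denotes.\<close>

lemma pm_inv_eqI:
  assumes "is_inverse n P Q"
  shows "pm_inv P = Q"
proof -
  have dim: "dim_vec P = n" using assms by (auto simp: is_inverse_def poly_map_def)
  have "Q' = Q" if "is_inverse n P Q'" for Q'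
  proof -
    have "Q' = pm_comp Q' (pm_comp P Q)"
      using assms that by (simp add: is_inverse_def pm_comp_id_right)
    also have "\<dots> = pm_comp (pm_comp Q' P) Q"
      using assms that by (intro pm_comp_assoc[symmetric]) (auto simp: is_inverse_def poly_map_def)
    also have "\<dots> = Q"
      using assms that by (simp add: is_inverse_def pm_comp_id_left poly_map_carrier)
    finally show ?thesis .
  qed
  with assms show ?thesis
    unfolding pm_inv_def dim by blast
qed

lemma pm_deg_le_iff: "0 < dim_vec P \<Longrightarrow> pm_deg P \<le> k \<longleftrightarrow> (\<forall>i<dim_vec P. total_degree (P $ i) \<le> k)"
  unfolding pm_deg_def by (subst Max_le_iff) auto

lemma total_degree_le_pm_deg: "i < dim_vec P \<Longrightarrow> total_degree (P $ i) \<le> pm_deg P"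
  unfolding pm_deg_def by (rule Max_ge) auto

lemma pm_deg_cong:
  assumes "dim_vec P = dim_vec Q" "\<And>i. i < dim_vec Q \<Longrightarrow> total_degree (P $ i) = total_degree (Q $ i)"
  shows "pm_deg P = pm_deg Q"
  unfolding pm_deg_def using assms by (intro arg_cong[of _ _ Max] image_cong) auto

text \<open>The maps of (i), (ii-a) and (iii) are all of this form, with \<open>\<Sum>i<n. a i * s i = 0\<close>; this
  makes \<open>lin n a\<close> invariant under the map.\<close>

definition shear :: "nat \<Rightarrow> (nat \<Rightarrow> 'a::comm_ring_1) \<Rightarrow> (nat \<Rightarrow> 'a poly) \<Rightarrow> 'a mpoly vec" where
  "shear n a s = vec n (\<lambda>i. Var i + poly_at (s i) (lin n a))"

lemma dim_shear [simp]: "dim_vec (shear n a s) = n"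
  by (simp add: shear_def)

lemma shear_carrier [simp]: "shear n a s \<in> carrier_vec n"
  by (simp add: shear_def)

lemma shear_index [simp]: "i < n \<Longrightarrow> shear n a s $ i = Var i + poly_at (s i) (lin n a)"
  by (simp add: shear_def)

lemma poly_map_shear: "poly_map n (shear n a s)"
proof -
  have "vars (Var i + poly_at (s i) (lin n a)) \<subseteq> {..<n}" if "i < n" for i
    using that by (intro order.trans[OF vars_add] Un_least vars_poly_at_lin) simp
  then show ?thesis by (simp add: poly_map_def)
qed

lemma perturbation_shear:
  assumes "\<And>i. i < n \<Longrightarrow> uterms_ge 2 (s i)"
  shows "perturbation n (shear n a s - pm_id n)"
  using assms terms_ge_poly_at[OF _ terms_ge_lin[of n a]]
  by (simp add: perturbation_def poly_map_def pm_id_def shear_def vars_poly_at_lin)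

context
  fixes n :: nat and a :: "nat \<Rightarrow> 'a::comm_ring_1" and s :: "nat \<Rightarrow> 'a poly"
  assumes orth: "(\<Sum>i<n. smult (a i) (s i)) = 0"
begin

text \<open>The perturbations contribute \<open>poly_at\<close> of the vanishing combination of the
  \<open>s i\<close>. This is the invariance of the linear form.\<close>

lemma lin_shear: "(\<Sum>i<n. Const (a i) * shear n a s $ i) = lin n a"
proof -
  have "(\<Sum>i<n. Const (a i) * poly_at (s i) (lin n a)) = poly_at (\<Sum>i<n. smult (a i) (s i)) (lin n a)"
    by (simp add: poly_at_sum poly_at_smult)
  then show ?thesis
    using orth by (simp add: distrib_left sum.distrib lin_def)
qed

text \<open>The right factor fixes the linear form at which the left one is evaluated, so
  perturbations simply add. Taking \<open>t = - s\<close> yields the inverse.\<close>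

lemma pm_comp_shear: "pm_comp (shear n a t) (shear n a s) = shear n a (\<lambda>i. s i + t i)"
proof (rule eq_vecI)
  have "psubst (\<lambda>j. shear n a s $ j) (lin n a) = lin n a"
    by (simp only: psubst_lin lin_shear)
  then show "pm_comp (shear n a t) (shear n a s) $ i = shear n a (\<lambda>i. s i + t i) $ i"
    if "i < dim_vec (shear n a (\<lambda>i. s i + t i))" for i
    using that by (simp add: pm_comp_index psubst.hom_add psubst_poly_at poly_at_add)
qed (simp add: pm_comp_def)

end

lemma shear_zero: "shear n a (\<lambda>i. 0) = pm_id n"
  by (simp add: shear_def pm_id_def)

lemma is_inverse_shear:
  assumes "(\<Sum>i<n. smult (a i) (s i)) = 0"
  shows "is_inverse n (shear n a s) (shear n a (\<lambda>i. - s i))"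
proof -
  have neg: "(\<Sum>i<n. smult (a i) (- s i)) = 0" using assms by (simp add: sum_negf)
  then show ?thesis
    using pm_comp_shear[OF assms, of "\<lambda>i. - s i"] pm_comp_shear[OF neg, of s]
    by (simp add: is_inverse_def poly_map_shear shear_zero)
qed

text \<open>The inverse differs only by the signs of the perturbations, which
  \<open>total_degree_Var_add\<close> cannot see; the degrees agree component by component.\<close>

lemma pm_deg_inv_shear:
  assumes "(\<Sum>i<n. smult (a i) (s i)) = 0" "\<And>i. i < n \<Longrightarrow> uterms_ge 2 (s i)"
  shows "pm_deg (pm_inv (shear n a s)) = pm_deg (shear n a s)"
  unfolding pm_inv_eqI[OF is_inverse_shear[OF assms(1)]]
proof (rule pm_deg_cong)
  fix i assume "i < dim_vec (shear n a s)"
  then show "total_degree (shear n a (\<lambda>i. - s i) $ i) = total_degree (shear n a s $ i)"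
    using assms(2) terms_ge_poly_at[OF _ terms_ge_lin, of 2 "s i" n a]
    by (simp add: poly_at_uminus total_degree_Var_add del: add_uminus_conv_diff)
qed simp

lemma pderiv_sum: "pderiv (\<Sum>x\<in>A. f x) = (\<Sum>x\<in>A. pderiv (f x))"
  by (induction A rule: infinite_finite_induct) (simp_all add: pderiv_add)

text \<open>By the chain rule the Jacobian matrix is 1 + u v^T with u_i = s_i'(\<xi>) and v_j = a_j.
  Differentiating the relation between the \<open>s i\<close> gives v.u = 0.\<close>

lemma J_shear:
  fixes a :: "nat \<Rightarrow> 'a::idom"
  assumes orth: "(\<Sum>i<n. smult (a i) (s i)) = 0" and n: "0 < n" "a (n - 1) \<noteq> 0"
  shows "J (shear n a s) = 1"
proof -
  obtain m where m: "n = Suc m" using n by (cases n) auto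
  define u v where "u i = poly_at (pderiv (s i)) (lin n a)" and "v j = Const (a j)" for i j
  have "(\<Sum>i<n. v i * u i) = poly_at (pderiv (\<Sum>i<n. smult (a i) (s i))) (lin n a)"
    by (simp add: u_def v_def pderiv_sum pderiv_smult poly_at_sum poly_at_smult)
  then have orth': "(\<Sum>i<Suc m. v i * u i) = 0" using orth m by simp
  have "jacobian (shear n a s) = mat n n (\<lambda>(i, j). (if i = j then 1 else 0) + u i * v j)"
    by (rule eq_matI)
      (auto simp: jacobian_def pd_add pd_Var pderiv_chain pd_lin u_def v_def)
  then show ?thesis
    using det_one_add_rank_one[OF orth'] n(2) by (simp add: J_def m v_def)
qed

lemma jacobian_id_add:
  assumes "f \<in> carrier_vec n"
  shows "jacobian (pm_id n + f) = 1\<^sub>m n + jacobian f"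
  using assms by (intro eq_matI) (auto simp: jacobian_def pm_id_def pd_add pd_Var)

lemma J_id_add:
  assumes "f \<in> carrier_vec n"
  shows "J (pm_id n + f) = 1 + (\<Sum>k=1..n. E k (jacobian f))"
proof -
  have "jacobian f \<in> carrier_mat n n" using assms by (simp add: jacobian_def)
  then show ?thesis
    unfolding J_def jacobian_id_add[OF assms] by (rule det_one_add_minor_sums)
qed

section \<open>Potentials\<close>

text \<open>For the lower bound, restrict to the k-th coordinate axis, scaled by 1 / a_k so that the
  linear form becomes the parameter; the restriction is then \<open>s\<close> itself.\<close>

lemma total_degree_poly_at_lin:
  fixes a :: "nat \<Rightarrow> 'a::field"
  assumes "k < n" "a k \<noteq> 0"
  shows "total_degree (poly_at s (lin n a)) = Polynomial.degree s"
proof (rule antisym)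
  show "total_degree (poly_at s (lin n a)) \<le> Polynomial.degree s"
    using total_degree_poly_at_le[OF total_degree_lin_le] by (metis mult.right_neutral)
  interpret C: comm_ring_hom "\<lambda>c::'a. [:c:]" by (rule comm_ring_hom_const_poly)
  define q where "q i = (if i = k then [:0, 1 / a k:] else 0)" for i
  interpret m: comm_ring_hom "meval (\<lambda>c::'a. [:c:]) q" by (rule C.comm_ring_hom_meval)
  have "(\<Sum>i<n. smult (a i) (q i)) = (\<Sum>i<n. if i = k then [:0, 1:] else 0)"
    using assms by (intro sum.cong) (auto simp: q_def)
  then have "meval (\<lambda>c. [:c:]) q (lin n a) = [:0, 1:]"
    using assms by (simp add: lin_def m.hom_sum m.hom_mult)
  then have "meval (\<lambda>c. [:c:]) q (poly_at s (lin n a)) = s"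
    by (simp only: meval_poly_at_pcompose pcompose_idR)
  moreover have "Polynomial.degree (q i) \<le> 1" for i by (simp add: q_def)
  ultimately show "Polynomial.degree s \<le> total_degree (poly_at s (lin n a))"
    using degree_meval_le[of q "poly_at s (lin n a)"] by simp
qed

lemma eq_vec_2I:
  assumes "dim_vec v = 2" "dim_vec w = 2" "v $ 0 = w $ 0" "v $ 1 = w $ 1"
  shows "v = w"
  by (rule eq_vecI) (use assms in \<open>auto simp: less_2_cases_iff\<close>)

lemma less_3_cases_iff: "i < 3 \<longleftrightarrow> i = 0 \<or> i = 1 \<or> i = (2::nat)"
  by auto

lemma eq_vec_3I:
  assumes "dim_vec v = 3" "dim_vec w = 3" "v $ 0 = w $ 0" "v $ 1 = w $ 1" "v $ 2 = w $ 2"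
  shows "v = w"
  by (rule eq_vecI) (use assms in \<open>auto simp: less_3_cases_iff\<close>)

lemma vec_index_vCons_2 [simp]: "vCons a v $ 2 = v $ 1"
  by (simp add: numeral_2_eq_2)

lemma lessThan_3: "{..<3} = {0, 1, 2::nat}"
  by auto

lemma lin2_eq_lin: "lin2 a b = lin 2 ((!) [a, b])"
  by (simp add: lin2_def lin_def numeral_2_eq_2)

lemma lin3_eq_lin: "lin3 a b c = lin 3 ((!) [a, b, c])"
  by (simp add: lin3_def lin_def lessThan_3 add.assoc)

lemma det_rows_2: "det (mat_of_rows_list 2 [[a, b], [c, d]]) = a * d - b * c"
  by (subst det_2, rule carrier_matI) (simp_all add: mat_of_rows_list_def)

lemma det_rows_3: "det (mat_of_rows_list 3 [[a, b, c], [d, e, f], [g, h, i]]) =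
    a * (e * i - f * h) - b * (d * i - f * g) + c * (d * h - e * g)"
  by (subst det_3, rule carrier_matI) (simp_all add: mat_of_rows_list_def)

lemma J_2:
  "J (pm_id 2 + vec_of_list [f, g]) = (1 + pd 0 f) * (1 + pd 1 g) - pd 1 f * pd 0 g"
proof -
  have v: "vec_of_list [f, g] \<in> carrier_vec 2" by (rule carrier_vecI) simp
  show ?thesis
    unfolding J_def jacobian_id_add[OF v] by (subst det_2, rule carrier_matI) (simp_all add: jacobian_def)
qed

text \<open>Grouped as 1 + E_1 + (E_2 + E_3), with the principal minors in the order of the theorem,
  so that for zero divergence the last bracket is literally the displayed sum.\<close>

lemma J_3:
  "J (pm_id 3 + vec_of_list [f, g, h]) = 1 + (pd 0 f + pd 1 g + pd 2 h) +
    (det (mat_of_rows_list 2 [[pd 0 f, pd 1 f], [pd 0 g, pd 1 g]]) +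
     det (mat_of_rows_list 2 [[pd 1 g, pd 2 g], [pd 1 h, pd 2 h]]) +
     det (mat_of_rows_list 2 [[pd 0 f, pd 2 f], [pd 0 h, pd 2 h]]) +
     det (mat_of_rows_list 3
       [[pd 0 f, pd 1 f, pd 2 f], [pd 0 g, pd 1 g, pd 2 g], [pd 0 h, pd 1 h, pd 2 h]]))"
proof -
  have v: "vec_of_list [f, g, h] \<in> carrier_vec 3" by (rule carrier_vecI) simp
  show ?thesis
    unfolding J_def jacobian_id_add[OF v] det_rows_2 det_rows_3
    by (subst det_3, rule carrier_matI) (simp_all add: jacobian_def algebra_simps)
qed

text \<open>Integrating \<open>f\<close> in direction \<open>j\<close> gives h up to a summand free
  of \<open>j\<close>. The error \<open>r\<close> in the second equation is free of \<open>j\<close>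
  because the divergence is zero, so subtracting its \<open>i\<close>-antiderivative repairs that
  equation without disturbing the first.\<close>

lemma ex_potential_2:
  fixes f g :: "'a::field_char_0 mpoly"
  assumes "i \<noteq> j" "pd i f + pd j g = 0" and V: "vars f \<subseteq> V" "vars g \<subseteq> V" "i \<in> V" "j \<in> V"
  shows "\<exists>h. vars h \<subseteq> V \<and> f = pd j h \<and> g = - pd i h"
proof -
  define r where "r = g + pd i (antideriv j f)"
  have "pd j r = 0"
    using assms(2) by (simp add: r_def pd_add pd_commute[of j i] add.commute)
  then have "pd j (antideriv i r) = 0"
    using assms(1) by (simp add: pd_antideriv_commute antideriv.zero)
  have v0: "vars (antideriv j f) \<subseteq> V"
    using vars_antideriv[of j f] V by blast
  have vr: "vars r \<subseteq> V"
    unfolding r_def by (intro order.trans[OF vars_add] Un_least V order.trans[OF vars_pd] v0)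
  have "vars (antideriv j f - antideriv i r) \<subseteq> V"
    using vars_antideriv[of i r] V vr
    by (intro order.trans[OF vars_minus] Un_least v0) blast
  moreover have "f = pd j (antideriv j f - antideriv i r)"
    using \<open>pd j (antideriv i r) = 0\<close> by (simp add: pd.diff)
  moreover have "g = - pd i (antideriv j f - antideriv i r)"
    by (simp add: pd.diff r_def)
  ultimately show ?thesis by blast
qed

text \<open>A potential is determined only up to a gradient, which leaves room to choose C = 0. Then
  f and g fix B and A up to terms free of z. The part \<open>r\<close> of \<open>h\<close> that is
  free of z is absorbed by the second term of A; the rest of \<open>h\<close> comes out right
  because the divergence vanishes.\<close>

lemma ex_potential_3:
  fixes f g h :: "'a::field_char_0 mpoly"
  assumes div: "pd 0 f + pd 1 g + pd 2 h = 0"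
    and V: "vars f \<subseteq> V" "vars g \<subseteq> V" "vars h \<subseteq> V" "1 \<in> V" "2 \<in> V"
  shows "\<exists>A B C. vars A \<subseteq> V \<and> vars B \<subseteq> V \<and> vars C \<subseteq> V \<and>
    f = pd 1 C - pd 2 B \<and> g = pd 2 A - pd 0 C \<and> h = pd 0 B - pd 1 A"
proof -
  define B where "B = - antideriv 2 f"
  define r where "r = h - antideriv 2 (pd 2 h)"
  define A where "A = antideriv 2 g - antideriv 1 r"
  have "pd 2 r = 0" by (simp add: r_def pd.diff)
  then have r: "pd 2 (antideriv 1 r) = 0"
    by (simp add: pd_antideriv_commute antideriv.zero)
  have vars_anti: "vars (antideriv i p) \<subseteq> V" if "vars p \<subseteq> V" "i \<in> V" for i and p :: "'a mpoly"
    using vars_antideriv[of i p] that by blast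
  have vr: "vars r \<subseteq> V"
    unfolding r_def by (intro order.trans[OF vars_minus] Un_least vars_anti order.trans[OF vars_pd] V)
  have "vars A \<subseteq> V"
    unfolding A_def by (intro order.trans[OF vars_minus] Un_least vars_anti vr V)
  moreover have "vars B \<subseteq> V" by (simp add: B_def vars_anti V)
  moreover have "f = pd 1 0 - pd 2 B" by (simp add: B_def pd.zero pd.minus)
  moreover have "g = pd 2 A - pd 0 0" using r by (simp add: A_def pd.zero pd.diff)
  moreover have "h = pd 0 B - pd 1 A"
  proof -
    have "pd 0 B - pd 1 A = h - antideriv 2 (pd 0 f + pd 1 g + pd 2 h)"
      by (simp add: A_def B_def r_def pd.minus pd.diff pd_antideriv_commute antideriv.add)
    then show ?thesis using div by (simp add: antideriv.zero)
  qed
  ultimately show ?thesis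
    by (intro exI[of _ A] exI[of _ B] exI[of _ 0]) simp
qed

text \<open>The first-order terms cancel in (1 + h_xy)(1 - h_xy) + h_xx h_yy.\<close>

lemma J_potential_2:
  assumes "f = pd 1 h" "g = - pd 0 h"
  shows "J (pm_id 2 + vec_of_list [f, g]) = 1 \<longleftrightarrow> pd2 0 0 h * pd2 1 1 h - (pd2 0 1 h)^2 = 0"
proof -
  have "J (pm_id 2 + vec_of_list [f, g]) = 1 + (pd2 0 0 h * pd2 1 1 h - (pd2 0 1 h)^2)"
    unfolding J_2 assms pd2_def pd.minus pd_commute[of 0 1]
    by (simp add: algebra_simps power2_eq_square)
  then show ?thesis by simp
qed

section \<open>The families along one linear form\<close>

lemma J_potential_3:
  assumes "f = pd 1 C - pd 2 B" "g = pd 2 A - pd 0 C" "h = pd 0 B - pd 1 A"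
    and div: "pd 0 f + pd 1 g + pd 2 h = 0"
  shows "J (pm_id 3 + vec_of_list [f, g, h]) = 1 \<longleftrightarrow>
     det (mat_of_rows_list 2
       [[pd2 0 1 C - pd2 0 2 B, pd2 1 1 C - pd2 1 2 B],
        [pd2 0 2 A - pd2 0 0 C, pd2 1 2 A - pd2 0 1 C]]) +
     det (mat_of_rows_list 2
       [[pd2 1 2 A - pd2 0 1 C, pd2 2 2 A - pd2 0 2 C],
        [pd2 0 1 B - pd2 1 1 A, pd2 0 2 B - pd2 1 2 A]]) +
     det (mat_of_rows_list 2
       [[pd2 0 1 C - pd2 0 2 B, pd2 1 2 C - pd2 2 2 B],
        [pd2 0 0 B - pd2 0 1 A, pd2 0 2 B - pd2 1 2 A]]) +
     det (mat_of_rows_list 3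
       [[pd2 0 1 C - pd2 0 2 B, pd2 1 1 C - pd2 1 2 B, pd2 1 2 C - pd2 2 2 B],
        [pd2 0 2 A - pd2 0 0 C, pd2 1 2 A - pd2 0 1 C, pd2 2 2 A - pd2 0 2 C],
        [pd2 0 0 B - pd2 0 1 A, pd2 0 1 B - pd2 1 1 A, pd2 0 2 B - pd2 1 2 A]]) = 0"
proof -
  \<comment> \<open>Mixed partials are sorted into the subscript order of the statement. The
    instances with \<open>Suc 0\<close> match the index 1 in its simplified form.\<close>
  have entries:
    "pd 0 f = pd2 0 1 C - pd2 0 2 B" "pd 1 f = pd2 1 1 C - pd2 1 2 B" "pd 2 f = pd2 1 2 C - pd2 2 2 B"
    "pd 0 g = pd2 0 2 A - pd2 0 0 C" "pd 1 g = pd2 1 2 A - pd2 0 1 C" "pd 2 g = pd2 2 2 A - pd2 0 2 C"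
    "pd 0 h = pd2 0 0 B - pd2 0 1 A" "pd 1 h = pd2 0 1 B - pd2 1 1 A" "pd 2 h = pd2 0 2 B - pd2 1 2 A"
    by (simp_all add: assms(1-3) pd.diff pd2_def pd_commute[of 0 1] pd_commute[of 0 2]
        pd_commute[of 1 2] pd_commute[of 0 "Suc 0"] pd_commute[of "Suc 0" 2])
  show ?thesis
    unfolding J_3 div by (simp only: entries add_0_right add_cancel_left_right)
qed

section \<open>The plane family\<close>

lemma fam2_eq_shear:
  "fam2 a b \<sigma> = shear 2 ((!) [a, b]) ((!) [smult b (pderiv \<sigma>), - smult a (pderiv \<sigma>)])"
  by (rule eq_vec_2I)
    (simp_all add: fam2_def Let_def lin2_eq_lin poly_at_smult poly_at_uminus)

lemma orth_2: "(\<Sum>i<2. smult ([a, b] ! i) ([smult b s, - smult a s] ! i)) = (0::'a::comm_ring_1 poly)"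
  by (simp add: numeral_2_eq_2 mult.commute)

lemma uterms_ge_smult: "uterms_ge k s \<Longrightarrow> uterms_ge k (smult c s)"
  by (simp add: uterms_ge_def)

lemma uterms_ge_uminus: "uterms_ge k s \<Longrightarrow> uterms_ge k (- s)" for s :: "'a::ab_group_add poly"
  by (simp add: uterms_ge_def)

lemma uterms_ge_sum: "(\<And>x. x \<in> A \<Longrightarrow> uterms_ge k (f x)) \<Longrightarrow> uterms_ge k (\<Sum>x\<in>A. f x)"
  by (simp add: uterms_ge_def coeff_sum)

lemma fam2_properties:
  fixes a b :: "'a::field_char_0"
  assumes \<sigma>: "uterms_ge 3 \<sigma>"
  defines "\<xi> \<equiv> lin2 a b" and "h \<equiv> poly_at \<sigma> (lin2 a b)" and "P \<equiv> fam2 a b \<sigma>"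
  shows "pd2 0 0 h * pd2 1 1 h - (pd2 0 1 h)^2 = 0"
    and "P = pm_id 2 + vec_of_list [pd 1 h, - pd 0 h]"
    and "perturbation 2 (vec_of_list [pd 1 h, - pd 0 h])"
    and "J P = 1"
    and "Const a * P $ 0 + Const b * P $ 1 = \<xi>"
    and "is_inverse 2 P (vec_of_list
          [Var 0 - Const b * poly_at (pderiv \<sigma>) \<xi>,
           Var 1 + Const a * poly_at (pderiv \<sigma>) \<xi>])"
    and "pm_deg (pm_inv P) = pm_deg P"
proof -
  have pd\<xi>: "pd 0 \<xi> = Const a" "pd 1 \<xi> = Const b"
    by (simp_all add: \<xi>_def lin2_eq_lin pd_lin)
  have pdh: "pd 0 h = poly_at (pderiv \<sigma>) \<xi> * Const a" "pd 1 h = poly_at (pderiv \<sigma>) \<xi> * Const b"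
    unfolding h_def \<xi>_def[symmetric] pderiv_chain pd\<xi> by simp_all
  \<comment> \<open>The Hessian matrix of \<sigma>(\<xi>) is \<sigma>''(\<xi>) times the rank-one
    matrix with rows a(a, b) and b(a, b).\<close>
  show hess: "pd2 0 0 h * pd2 1 1 h - (pd2 0 1 h)^2 = 0"
    unfolding pd2_def pdh pd_mult pd_Const pderiv_chain pd\<xi>
    by (simp add: power2_eq_square algebra_simps)
  show P: "P = pm_id 2 + vec_of_list [pd 1 h, - pd 0 h]"
    unfolding pdh P_def fam2_def Let_def \<xi>_def[symmetric]
    by (rule eq_vec_2I) (simp_all add: pm_id_def mult.commute)
  have s: "uterms_ge 2 ([smult b (pderiv \<sigma>), - smult a (pderiv \<sigma>)] ! i)" if "i < 2" for i
  proof -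
    have "uterms_ge 2 (pderiv \<sigma>)" using \<sigma> by (intro uterms_ge_pderiv) (simp add: eval_nat_numeral)
    then show ?thesis using that
      by (auto simp: less_2_cases_iff uterms_ge_smult uterms_ge_uminus)
  qed
  have "P - pm_id 2 = vec_of_list [pd 1 h, - pd 0 h]"
    unfolding P by (rule eq_vec_2I) (simp_all add: pm_id_def)
  then show "perturbation 2 (vec_of_list [pd 1 h, - pd 0 h])"
    using perturbation_shear[where s = "(!) [smult b (pderiv \<sigma>), - smult a (pderiv \<sigma>)]", OF s]
    by (metis P_def fam2_eq_shear)
  \<comment> \<open>\<open>J_shear\<close> would require b to be nonzero. The Hessian criterion
    covers all a and b, including a = b = 0.\<close>
  show "J P = 1"
    unfolding P using J_potential_2[OF refl refl, of h] hess by simp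
  show "Const a * P $ 0 + Const b * P $ 1 = \<xi>"
    using lin_shear[OF orth_2[of a b "pderiv \<sigma>"]]
    by (simp add: P_def \<xi>_def fam2_eq_shear lin2_eq_lin numeral_2_eq_2)
  have "vec_of_list [Var 0 - Const b * poly_at (pderiv \<sigma>) \<xi>, Var 1 + Const a * poly_at (pderiv \<sigma>) \<xi>] =
      shear 2 ((!) [a, b]) (\<lambda>i. - [smult b (pderiv \<sigma>), - smult a (pderiv \<sigma>)] ! i)"
    by (rule eq_vec_2I) (simp_all add: \<xi>_def lin2_eq_lin poly_at_smult poly_at_uminus)
  then show "is_inverse 2 P (vec_of_list
          [Var 0 - Const b * poly_at (pderiv \<sigma>) \<xi>,
           Var 1 + Const a * poly_at (pderiv \<sigma>) \<xi>])"
    using is_inverse_shear[OF orth_2[of a b "pderiv \<sigma>"]] by (simp only: P_def fam2_eq_shear)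
  show "pm_deg (pm_inv P) = pm_deg P"
    unfolding P_def fam2_eq_shear by (rule pm_deg_inv_shear[OF orth_2 s])
qed

lemma ex_fam2_deg:
  assumes "d \<ge> 2"
  shows "\<exists>(a::'a::field_char_0) b \<sigma>. uterms_ge 3 \<sigma> \<and> pm_deg (fam2 a b \<sigma>) = d"
proof (intro exI conjI)
  \<comment> \<open>With a = 0, b = 1 the map is (x + (d + 1) y^d, y). Its degree is d because d + 1
    is nonzero in characteristic zero.\<close>
  let ?\<sigma> = "monom 1 (Suc d) :: 'a poly"
  show \<sigma>: "uterms_ge 3 ?\<sigma>" using assms by (simp add: uterms_ge_def)
  have s: "uterms_ge 2 (pderiv ?\<sigma>)"
    using \<sigma> by (intro uterms_ge_pderiv) (simp add: eval_nat_numeral)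
  have deg: "total_degree (poly_at (pderiv ?\<sigma>) (lin 2 ((!) [0, 1]))) = d"
    by (subst total_degree_poly_at_lin[of 1]) (simp_all add: degree_pderiv degree_monom_eq)
  define P where "P = fam2 (0::'a) 1 ?\<sigma>"
  have P: "P = shear 2 ((!) [0, 1]) ((!) [pderiv ?\<sigma>, 0])"
    by (simp add: P_def fam2_eq_shear)
  have t: "total_degree (P $ 0) = d" "total_degree (P $ 1) = 1" "dim_vec P = 2"
    using assms deg terms_ge_poly_at[OF s terms_ge_lin[of 2 "(!) [0, 1]"]]
    by (simp_all add: P total_degree_Var_add)
  have "pm_deg P = d"
  proof (rule antisym)
    show "pm_deg P \<le> d" using assms t by (subst pm_deg_le_iff) (auto simp: less_2_cases_iff)
    show "d \<le> pm_deg P" using total_degree_le_pm_deg[of 0 P] t by simp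
  qed
  then show "pm_deg (fam2 (0::'a) 1 ?\<sigma>) = d" by (simp add: P_def)
qed

text \<open>The last perturbation is the one forced by sum a_i s_i = 0, solved for s_n by dividing
  by a_n.\<close>

lemma famn_eq_shear:
  "famn n a \<phi> = shear n a (\<lambda>i. if i < n - 1 then \<phi> i else - (\<Sum>j<n - 1. smult (a j / a (n - 1)) (\<phi> j)))"
  by (rule eq_vecI)
    (auto simp: famn_def Let_def poly_at_uminus poly_at_sum poly_at_smult
      intro!: arg_cong[of _ _ Var])

lemma smult_sum_right: "smult c (\<Sum>x\<in>A. f x) = (\<Sum>x\<in>A. smult c (f x))"
  by (induction A rule: infinite_finite_induct) (simp_all add: smult_add_right)

lemma orth_n:
  fixes a :: "nat \<Rightarrow> 'a::field"
  assumes "0 < n" "a (n - 1) \<noteq> 0"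
  shows "(\<Sum>i<n. smult (a i) (if i < n - 1 then \<phi> i else - (\<Sum>j<n - 1. smult (a j / a (n - 1)) (\<phi> j)))) = 0"
proof -
  obtain m where m: "n = Suc m" using assms(1) by (cases n) auto
  have "smult (a m) (\<Sum>j<m. smult (a j / a m) (\<phi> j)) = (\<Sum>j<m. smult (a j) (\<phi> j))"
    using assms(2) m by (simp add: smult_sum_right)
  then show ?thesis by (simp add: m)
qed

lemma famn_properties:
  fixes a :: "nat \<Rightarrow> 'a::field_char_0"
  assumes n: "0 < n" "a (n - 1) \<noteq> 0" and \<phi>: "\<And>i. i < n - 1 \<Longrightarrow> uterms_ge 2 (\<phi> i)"
  defines "\<xi> \<equiv> lin n a" and "P \<equiv> famn n a \<phi>"
  shows "perturbation n (P - pm_id n)"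
    and "J P = 1"
    and "(\<Sum>i<n. Const (a i) * P $ i) = \<xi>"
    and "is_inverse n P (vec n (\<lambda>i. if i < n - 1 then Var i - poly_at (\<phi> i) \<xi>
          else Var (n - 1) + (\<Sum>j<n - 1. Const (a j / a (n - 1)) * poly_at (\<phi> j) \<xi>)))"
    and "pm_deg (pm_inv P) = pm_deg P"
proof -
  let ?s = "\<lambda>i. if i < n - 1 then \<phi> i else - (\<Sum>j<n - 1. smult (a j / a (n - 1)) (\<phi> j))"
  have s: "uterms_ge 2 (?s i)" for i
    using \<phi> by (auto intro!: uterms_ge_uminus uterms_ge_sum uterms_ge_smult)
  note orth = orth_n[of n a, OF n]
  note P = P_def[unfolded famn_eq_shear]
  show "perturbation n (P - pm_id n)"
    unfolding P by (rule perturbation_shear) (rule s)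
  show "J P = 1"
    unfolding P by (rule J_shear[OF orth n])
  show "(\<Sum>i<n. Const (a i) * P $ i) = \<xi>"
    unfolding P \<xi>_def by (rule lin_shear[OF orth])
  have "vec n (\<lambda>i. if i < n - 1 then Var i - poly_at (\<phi> i) \<xi>
          else Var (n - 1) + (\<Sum>j<n - 1. Const (a j / a (n - 1)) * poly_at (\<phi> j) \<xi>)) =
      shear n a (\<lambda>i. - ?s i)"
    by (rule eq_vecI)
      (auto simp: \<xi>_def poly_at_uminus poly_at_sum poly_at_smult intro!: arg_cong[of _ _ Var])
  then show "is_inverse n P (vec n (\<lambda>i. if i < n - 1 then Var i - poly_at (\<phi> i) \<xi>
          else Var (n - 1) + (\<Sum>j<n - 1. Const (a j / a (n - 1)) * poly_at (\<phi> j) \<xi>)))"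
    using is_inverse_shear[OF orth] by (simp only: P)
  show "pm_deg (pm_inv P) = pm_deg P"
    unfolding P by (rule pm_deg_inv_shear[OF orth s])
qed

lemma fam3a_eq_famn: "fam3a a b c \<phi> \<psi> = famn 3 ((!) [a, b, c]) ((!) [\<phi>, \<psi>])"
  by (rule eq_vec_3I)
    (simp_all add: fam3a_def famn_def Let_def lin3_eq_lin numeral_2_eq_2 diff_diff_eq)

lemma fam3a_properties:
  fixes a b c :: "'a::field_char_0"
  assumes c: "c \<noteq> 0" and \<phi>: "uterms_ge 2 \<phi>" and \<psi>: "uterms_ge 2 \<psi>"
  defines "\<xi> \<equiv> lin3 a b c" and "P \<equiv> fam3a a b c \<phi> \<psi>"
  shows "perturbation 3 (P - pm_id 3)"
    and "J P = 1"
    and "Const a * P $ 0 + Const b * P $ 1 + Const c * P $ 2 = \<xi>"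
    and "is_inverse 3 P (vec_of_list
          [Var 0 - poly_at \<phi> \<xi>,
           Var 1 - poly_at \<psi> \<xi>,
           Var 2 + Const (a / c) * poly_at \<phi> \<xi> + Const (b / c) * poly_at \<psi> \<xi>])"
    and "pm_deg (pm_inv P) = pm_deg P"
proof -
  let ?a = "(!) [a, b, c]"
  have "uterms_ge 2 ([\<phi>, \<psi>] ! i)" if "i < 3 - 1" for i
    using that \<phi> \<psi> by (auto simp: less_2_cases_iff)
  note props = famn_properties[of 3 ?a "(!) [\<phi>, \<psi>]", OF _ _ this, folded fam3a_eq_famn, folded P_def]
  show "perturbation 3 (P - pm_id 3)" "J P = 1" "pm_deg (pm_inv P) = pm_deg P"
    using props(1,2,5) c by simp_all
  show "Const a * P $ 0 + Const b * P $ 1 + Const c * P $ 2 = \<xi>"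
    using props(3) c by (simp add: lessThan_3 \<xi>_def lin3_eq_lin add.assoc)
  have "vec_of_list [Var 0 - poly_at \<phi> \<xi>, Var 1 - poly_at \<psi> \<xi>,
        Var 2 + Const (a / c) * poly_at \<phi> \<xi> + Const (b / c) * poly_at \<psi> \<xi>] =
      vec 3 (\<lambda>i. if i < 3 - 1 then Var i - poly_at ([\<phi>, \<psi>] ! i) (lin 3 ?a)
          else Var (3 - 1) + (\<Sum>j<3 - 1. Const (?a j / ?a (3 - 1)) * poly_at ([\<phi>, \<psi>] ! j) (lin 3 ?a)))"
    by (rule eq_vec_3I) (simp_all add: \<xi>_def lin3_eq_lin numeral_2_eq_2 add.assoc)
  then show "is_inverse 3 P (vec_of_list
          [Var 0 - poly_at \<phi> \<xi>,
           Var 1 - poly_at \<psi> \<xi>,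
           Var 2 + Const (a / c) * poly_at \<phi> \<xi> + Const (b / c) * poly_at \<psi> \<xi>])"
    using props(4) c by simp
qed

section \<open>The family along two linear forms\<close>

lemma All_less_3: "(\<forall>i<3. P i) \<longleftrightarrow> P 0 \<and> P 1 \<and> P (2::nat)"
  by (auto simp: less_3_cases_iff)

lemma poly_map_vec_3:
  "poly_map 3 (vec_of_list [f, g, h]) \<longleftrightarrow> vars f \<subseteq> {..<3} \<and> vars g \<subseteq> {..<3} \<and> vars h \<subseteq> {..<3}"
  by (simp add: poly_map_def All_less_3 carrier_vecI)

lemma vars_Const_mult_subset: "vars t \<subseteq> V \<Longrightarrow> vars (Const k * t) \<subseteq> V"
  using vars_mult[of "Const k" t] by simp

text \<open>Common shape of \<open>fam3b\<close> and its inverse. The arguments \<xi> and \<eta> are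
  arbitrary polynomials because in the inverse one of them is a linear form plus a nonlinear
  correction.\<close>

definition shear3 ::
  "'a::comm_ring_1 \<Rightarrow> 'a \<Rightarrow> 'a poly \<Rightarrow> 'a poly \<Rightarrow> 'a mpoly \<Rightarrow> 'a mpoly \<Rightarrow> 'a mpoly vec" where
  "shear3 \<alpha> \<beta> \<phi> \<psi> \<xi> \<eta> = vec_of_list
     [Var 0 + poly_at \<phi> \<xi>,
      Var 1 + poly_at \<psi> \<eta>,
      Var 2 - Const \<alpha> * poly_at \<phi> \<xi> - Const \<beta> * poly_at \<psi> \<eta>]"

lemma shear3_simps [simp]:
  "dim_vec (shear3 \<alpha> \<beta> \<phi> \<psi> \<xi> \<eta>) = 3"
  "shear3 \<alpha> \<beta> \<phi> \<psi> \<xi> \<eta> $ 0 = Var 0 + poly_at \<phi> \<xi>"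
  "shear3 \<alpha> \<beta> \<phi> \<psi> \<xi> \<eta> $ 1 = Var 1 + poly_at \<psi> \<eta>"
  "shear3 \<alpha> \<beta> \<phi> \<psi> \<xi> \<eta> $ Suc 0 = Var 1 + poly_at \<psi> \<eta>"
  "shear3 \<alpha> \<beta> \<phi> \<psi> \<xi> \<eta> $ 2 = Var 2 - Const \<alpha> * poly_at \<phi> \<xi> - Const \<beta> * poly_at \<psi> \<eta>"
  by (simp_all add: shear3_def)

lemma fam3b_eq_shear3:
  "fam3b a b c p q r \<phi> \<psi> = shear3 (a / c) (q / r) \<phi> \<psi> (lin3 a b c) (lin3 p q r)"
  by (simp only: fam3b_def shear3_def Let_def)

lemma poly_map_shear3:
  assumes "vars \<xi> \<subseteq> {..<3}" "vars \<eta> \<subseteq> {..<3}"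
  shows "poly_map 3 (shear3 \<alpha> \<beta> \<phi> \<psi> \<xi> \<eta>)"
proof -
  have v: "vars (poly_at \<phi> \<xi>) \<subseteq> {..<3}" "vars (poly_at \<psi> \<eta>) \<subseteq> {..<3}"
    using assms vars_poly_at by blast+
  show ?thesis
    unfolding shear3_def poly_map_vec_3
    by (intro conjI order.trans[OF vars_add] order.trans[OF vars_minus] Un_least v vars_Const_mult_subset) simp_all
qed

lemma psubst_lin3: "psubst q (lin3 a b c) = Const a * q 0 + Const b * q 1 + Const c * q 2"
  by (simp add: lin3_def psubst.hom_add psubst.hom_mult)

text \<open>The effect of the map on any linear form. For \<alpha> = a/c the form \<xi> gets no
  \<phi>-term, and for \<beta> = q/r the form \<eta> gets no \<psi>-term. Of the two remaining
  coefficients, each equality on the parameters kills one, so that one form is invariant.\<close>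

lemma psubst_shear3_lin3:
  "psubst (\<lambda>i. shear3 \<alpha> \<beta> \<phi> \<psi> \<xi> \<eta> $ i) (lin3 a b c) =
     lin3 a b c + Const (a - c * \<alpha>) * poly_at \<phi> \<xi> + Const (b - c * \<beta>) * poly_at \<psi> \<eta>"
  unfolding psubst_lin3 by (simp add: lin3_def Const.hom_minus Const.hom_mult algebra_simps)

text \<open>Once \<open>S\<close> carries the new arguments back to the old ones, the perturbations
  cancel in every component.\<close>

lemma pm_comp_shear3:
  fixes \<alpha> \<beta> \<phi> \<psi> \<xi> \<eta>
  defines "S \<equiv> shear3 \<alpha> \<beta> \<phi> \<psi> \<xi> \<eta>"
  assumes "psubst (\<lambda>i. S $ i) \<xi>' = \<xi>" "psubst (\<lambda>i. S $ i) \<eta>' = \<eta>"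
  shows "pm_comp (shear3 \<alpha> \<beta> (- \<phi>) (- \<psi>) \<xi>' \<eta>') S = pm_id 3"
proof (rule eq_vec_3I)
  note simps = pm_comp_index psubst.hom_add psubst.hom_minus psubst.hom_mult psubst_poly_at
    assms(2,3) poly_at_uminus pm_id_def
  show "pm_comp (shear3 \<alpha> \<beta> (- \<phi>) (- \<psi>) \<xi>' \<eta>') S $ 0 = pm_id 3 $ 0"
    by (simp add: simps) (simp add: S_def)
  show "pm_comp (shear3 \<alpha> \<beta> (- \<phi>) (- \<psi>) \<xi>' \<eta>') S $ 1 = pm_id 3 $ 1"
    by (simp add: simps) (simp add: S_def)
  show "pm_comp (shear3 \<alpha> \<beta> (- \<phi>) (- \<psi>) \<xi>' \<eta>') S $ 2 = pm_id 3 $ 2"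
    by (simp add: simps) (simp add: S_def)
qed (simp_all add: pm_comp_def pm_id_def)

lemma is_inverse_shear3:
  fixes \<alpha> \<beta> \<phi> \<psi> \<xi> \<eta> \<xi>' \<eta>'
  defines "S \<equiv> shear3 \<alpha> \<beta> \<phi> \<psi> \<xi> \<eta>" and "T \<equiv> shear3 \<alpha> \<beta> (- \<phi>) (- \<psi>) \<xi>' \<eta>'"
  assumes "vars \<xi> \<subseteq> {..<3}" "vars \<eta> \<subseteq> {..<3}" "vars \<xi>' \<subseteq> {..<3}" "vars \<eta>' \<subseteq> {..<3}"
    and "psubst (\<lambda>i. S $ i) \<xi>' = \<xi>" "psubst (\<lambda>i. S $ i) \<eta>' = \<eta>"
    and "psubst (\<lambda>i. T $ i) \<xi> = \<xi>'" "psubst (\<lambda>i. T $ i) \<eta> = \<eta>'"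
  shows "is_inverse 3 S T"
proof -
  have "pm_comp T S = pm_id 3"
    using assms(7,8) unfolding S_def T_def by (rule pm_comp_shear3)
  moreover have "pm_comp S T = pm_id 3"
    using pm_comp_shear3[of \<alpha> \<beta> "- \<phi>" "- \<psi>" \<xi>' \<eta>' \<xi> \<eta>] assms(9,10)
    by (simp add: S_def T_def)
  ultimately show ?thesis
    using assms(3-6) by (simp add: is_inverse_def S_def T_def poly_map_shear3)
qed

lemma vars_lin3: "vars (lin3 x y z) \<subseteq> {..<3}"
  unfolding lin3_eq_lin by (rule vars_lin)

lemma vars_lin3_minus: "vars (lin3 x y z - Const k * poly_at s (lin3 x' y' z')) \<subseteq> {..<3}"
  by (intro order.trans[OF vars_minus] Un_least vars_Const_mult_subset order.trans[OF vars_poly_at] vars_lin3)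

lemma perturbation_fam3b:
  assumes "uterms_ge 2 \<phi>" "uterms_ge 2 \<psi>"
  shows "perturbation 3 (fam3b a b c p q r \<phi> \<psi> - pm_id 3)"
proof -
  let ?f = "poly_at \<phi> (lin3 a b c)" and ?g = "poly_at \<psi> (lin3 p q r)"
  have eq: "fam3b a b c p q r \<phi> \<psi> - pm_id 3 =
      vec_of_list [?f, ?g, - (Const (a / c) * ?f) - Const (q / r) * ?g]"
    by (rule eq_vec_3I) (simp_all add: fam3b_eq_shear3 pm_id_def)
  have v: "vars ?f \<subseteq> {..<3}" "vars ?g \<subseteq> {..<3}"
    unfolding lin3_eq_lin by (rule vars_poly_at_lin)+
  have "vars (- (Const (a / c) * ?f) - Const (q / r) * ?g) \<subseteq> {..<3}"
    by (intro order.trans[OF vars_minus] Un_least, unfold vars_uminus)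
      (intro vars_Const_mult_subset v)+
  then have "poly_map 3 (fam3b a b c p q r \<phi> \<psi> - pm_id 3)"
    unfolding eq poly_map_vec_3 using v by simp
  moreover have "terms_ge 2 ?f" "terms_ge 2 ?g"
    unfolding lin3_eq_lin by (intro terms_ge_poly_at terms_ge_lin assms)+
  ultimately show ?thesis
    by (simp add: perturbation_def eq All_less_3 terms_ge_minus terms_ge_mult_left)
qed

lemma pm_deg_shear3_le:
  assumes "total_degree \<xi> \<le> D" "total_degree \<eta> \<le> D" "1 \<le> D"
    and "Polynomial.degree s \<le> D" "Polynomial.degree t \<le> D"
  shows "pm_deg (shear3 \<alpha> \<beta> s t \<xi> \<eta>) \<le> D\<^sup>2"
proof -
  have 1: "1 \<le> D\<^sup>2" using assms(3) by simp
  have "total_degree (poly_at s \<xi>) \<le> D\<^sup>2" "total_degree (poly_at t \<eta>) \<le> D\<^sup>2"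
    unfolding power2_eq_square
    using order.trans[OF total_degree_poly_at_le[OF assms(1)] mult_le_mono1[OF assms(4)]]
      order.trans[OF total_degree_poly_at_le[OF assms(2)] mult_le_mono1[OF assms(5)]] by blast+
  then have "total_degree (shear3 \<alpha> \<beta> s t \<xi> \<eta> $ i) \<le> D\<^sup>2" if "i < 3" for i
    using 1 that unfolding less_3_cases_iff
    by (elim disjE) (simp_all add: total_degree_add_le total_degree_minus_le total_degree_Const_mult_le)
  then show ?thesis by (subst pm_deg_le_iff) simp_all
qed

lemma total_degree_lin3_minus_le:
  assumes "1 \<le> D" "Polynomial.degree s \<le> D"
  shows "total_degree (lin3 x y z - Const k * poly_at s (lin3 x' y' z')) \<le> D"
proof -
  have "total_degree (lin3 x y z) \<le> D"
    unfolding lin3_eq_lin using total_degree_lin_le assms(1) by (rule order.trans)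
  moreover have "total_degree (poly_at s (lin3 x' y' z')) \<le> D"
    using total_degree_poly_at_le[OF total_degree_lin_le] assms(2) unfolding lin3_eq_lin
    by (metis mult.right_neutral order.trans)
  ultimately show ?thesis
    by (intro total_degree_minus_le total_degree_Const_mult_le)
qed

context
  fixes a b c p q r :: "'a::field_char_0" and \<phi> \<psi> :: "'a poly"
  assumes cr: "c \<noteq> 0" "r \<noteq> 0"
begin

lemma is_inverse_fam3b_1:
  assumes "a * r = c * p"
  shows "is_inverse 3 (fam3b a b c p q r \<phi> \<psi>) (shear3 (a / c) (q / r) (- \<phi>) (- \<psi>)
    (lin3 a b c - Const (b - c * q / r) * poly_at \<psi> (lin3 p q r)) (lin3 p q r))"
proof -
  \<comment> \<open>This is the coefficient of \<phi>(\<xi>) in the image of \<eta>, so \<eta> is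
    invariant and \<xi> is shifted by a multiple of \<psi>(\<eta>).\<close>
  have "p - r * (a / c) = 0" using assms cr by (simp add: field_simps)
  then show ?thesis
    unfolding fam3b_eq_shear3 using cr
    by (intro is_inverse_shear3 vars_lin3 vars_lin3_minus)
      (simp_all add: psubst_shear3_lin3 psubst.hom_minus psubst.hom_mult psubst_poly_at poly_at_uminus)
qed

lemma is_inverse_fam3b_2:
  assumes "b * r = c * q"
  shows "is_inverse 3 (fam3b a b c p q r \<phi> \<psi>) (shear3 (a / c) (q / r) (- \<phi>) (- \<psi>)
    (lin3 a b c) (lin3 p q r - Const (p - a * r / c) * poly_at \<phi> (lin3 a b c)))"
proof -
  \<comment> \<open>The mirror case: the coefficient of \<psi>(\<eta>) in the image of \<xi>
    vanishes, so \<xi> is invariant and \<eta> is shifted by a multiple of \<phi>(\<xi>).\<close>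
  have "b - c * (q / r) = 0" using assms cr by (simp add: field_simps)
  then show ?thesis
    unfolding fam3b_eq_shear3 using cr
    by (intro is_inverse_shear3 vars_lin3 vars_lin3_minus)
      (simp_all add: psubst_shear3_lin3 psubst.hom_minus psubst.hom_mult psubst_poly_at poly_at_uminus
        mult.commute)
qed

text \<open>The Jacobian matrix is 1 + u v^T + u' v'^T with u = (1, 0, -\<alpha>), u' = (0, 1,
  -\<beta>) and v, v' multiples of the coefficient vectors of \<xi>, \<eta>. As v.u = v'.u' = 0, the
  determinant is 1 - (v.u')(v'.u), and the hypothesis makes one of the mixed products zero.\<close>

lemma J_fam3b:
  assumes "a * r = c * p \<or> b * r = c * q"
  shows "J (fam3b a b c p q r \<phi> \<psi>) = 1"
proof -
  define \<alpha> \<beta> where "\<alpha> = a / c" and "\<beta> = q / r"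
  let ?\<xi> = "lin3 a b c" and ?\<eta> = "lin3 p q r"
  let ?f = "poly_at \<phi> ?\<xi>" and ?g = "poly_at \<psi> ?\<eta>"
  let ?h = "- (Const \<alpha> * ?f + Const \<beta> * ?g)"
  have P: "fam3b a b c p q r \<phi> \<psi> = pm_id 3 + vec_of_list [?f, ?g, ?h]"
    by (rule eq_vec_3I)
      (simp_all add: fam3b_eq_shear3 pm_id_def \<alpha>_def \<beta>_def)
  \<comment> \<open>Eliminating \<open>a\<close> and \<open>q\<close> instead of dividing turns the
    determinant expansion into a pure ring identity.\<close>
  have a: "a = c * \<alpha>" and q: "q = r * \<beta>" using cr by (simp_all add: \<alpha>_def \<beta>_def)
  have "\<alpha> * r = p \<or> b = \<beta> * c"
    using assms cr by (auto simp: \<alpha>_def \<beta>_def field_simps)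
  then have "(\<alpha> * r - p) * (b - \<beta> * c) = 0" by auto
  then have k: "(Const \<alpha> * Const r - Const p) * (Const b - Const \<beta> * Const c) = 0"
    by (simp flip: Const.hom_mult Const.hom_minus)
  have pds: "pd 0 ?\<xi> = Const c * Const \<alpha>" "pd 1 ?\<xi> = Const b" "pd 2 ?\<xi> = Const c"
    "pd 0 ?\<eta> = Const p" "pd 1 ?\<eta> = Const r * Const \<beta>" "pd 2 ?\<eta> = Const r"
    unfolding a q by (simp_all add: lin3_eq_lin pd_lin Const.hom_mult)
  let ?F = "poly_at (pderiv \<phi>) ?\<xi>" and ?G = "poly_at (pderiv \<psi>) ?\<eta>"
  have "J (pm_id 3 + vec_of_list [?f, ?g, ?h]) =
      1 + ?F * ?G * ((Const \<alpha> * Const r - Const p) * (Const b - Const \<beta> * Const c))"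
    unfolding J_3 det_rows_2 det_rows_3 pd.minus pd_add pd_Const_mult pderiv_chain pds
    by (simp add: algebra_simps)
  then show ?thesis unfolding P k by simp
qed

lemma pm_deg_fam3b:
  assumes "uterms_ge 2 \<phi>" "uterms_ge 2 \<psi>"
  shows "pm_deg (fam3b a b c p q r \<phi> \<psi>) = max 1 (max (Polynomial.degree \<phi>) (Polynomial.degree \<psi>))"
proof -
  let ?P = "fam3b a b c p q r \<phi> \<psi>"
  have t: "terms_ge 2 (poly_at \<phi> (lin3 a b c))" "terms_ge 2 (poly_at \<psi> (lin3 p q r))"
    unfolding lin3_eq_lin by (intro terms_ge_poly_at terms_ge_lin assms)+
  have d: "total_degree (poly_at \<phi> (lin3 a b c)) = Polynomial.degree \<phi>"
    "total_degree (poly_at \<psi> (lin3 p q r)) = Polynomial.degree \<psi>"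
    unfolding lin3_eq_lin using cr by (simp_all add: total_degree_poly_at_lin[of 2])
  have P0: "total_degree (?P $ 0) = max 1 (Polynomial.degree \<phi>)"
    and P1: "total_degree (?P $ 1) = max 1 (Polynomial.degree \<psi>)"
    using t by (simp_all add: fam3b_eq_shear3 total_degree_Var_add d)
  \<comment> \<open>An upper bound is enough here, and terms of the third component may cancel; the
    first two components already attain the maximum.\<close>
  have P2: "total_degree (?P $ 2) \<le> max 1 (max (Polynomial.degree \<phi>) (Polynomial.degree \<psi>))"
    unfolding fam3b_eq_shear3 shear3_simps
    by (intro total_degree_minus_le total_degree_Const_mult_le) (simp_all add: d)
  have dim: "dim_vec ?P = 3" by (simp add: fam3b_eq_shear3)
  show ?thesis
  proof (rule antisym)
    show "pm_deg ?P \<le> max 1 (max (Polynomial.degree \<phi>) (Polynomial.degree \<psi>))"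
      using P0 P1 P2 by (subst pm_deg_le_iff) (auto simp: dim All_less_3)
    show "max 1 (max (Polynomial.degree \<phi>) (Polynomial.degree \<psi>)) \<le> pm_deg ?P"
      using total_degree_le_pm_deg[of 0 ?P] total_degree_le_pm_deg[of 1 ?P] P0 P1 dim by simp
  qed
qed

lemma pm_deg_inv_fam3b_le:
  assumes "uterms_ge 2 \<phi>" "uterms_ge 2 \<psi>" "a * r = c * p \<or> b * r = c * q"
  shows "pm_deg (pm_inv (fam3b a b c p q r \<phi> \<psi>)) \<le> (pm_deg (fam3b a b c p q r \<phi> \<psi>))\<^sup>2"
proof -
  define D where "D = pm_deg (fam3b a b c p q r \<phi> \<psi>)"
  have D: "1 \<le> D" "Polynomial.degree \<phi> \<le> D" "Polynomial.degree \<psi> \<le> D"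
    by (simp_all add: D_def pm_deg_fam3b assms)
  \<comment> \<open>The instance with zero polynomial and zero factor bounds the unshifted linear
    form.\<close>
  note lin = total_degree_lin3_minus_le[OF D(1), of 0 _ _ _ 0, simplified]
  from assms(3) show ?thesis
    unfolding D_def[symmetric]
  proof
    assume "a * r = c * p"
    from pm_inv_eqI[OF is_inverse_fam3b_1[OF this]] show "pm_deg (pm_inv (fam3b a b c p q r \<phi> \<psi>)) \<le> D\<^sup>2"
      by (simp only:) (intro pm_deg_shear3_le total_degree_lin3_minus_le lin D, simp_all add: D)
  next
    assume "b * r = c * q"
    from pm_inv_eqI[OF is_inverse_fam3b_2[OF this]] show "pm_deg (pm_inv (fam3b a b c p q r \<phi> \<psi>)) \<le> D\<^sup>2"
      by (simp only:) (intro pm_deg_shear3_le total_degree_lin3_minus_le lin D, simp_all add: D)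
  qed
qed

end

lemma ex_fam3b_deg:
  assumes "d \<ge> 2"
  shows "\<exists>(a::'a::field_char_0) b c p q r \<phi> \<psi>. params3b a b c p q r \<phi> \<psi> \<and>
      pm_deg (fam3b a b c p q r \<phi> \<psi>) = d \<and>
      pm_deg (pm_inv (fam3b a b c p q r \<phi> \<psi>)) = d^2"
proof -
  define \<phi> where "\<phi> = (monom 1 d :: 'a poly)"
  have \<phi>: "uterms_ge 2 \<phi>" "Polynomial.degree \<phi> = d"
    using assms by (simp_all add: \<phi>_def uterms_ge_def degree_monom_eq)
  \<comment> \<open>The map is u = x + (y + z)^d, v = y + z^d, w = z, with x = u - (v + w - w^d)^d
    in the inverse. Here ar = cp = 0, while br = 1 and cq = 0.\<close>
  let ?P = "fam3b (0::'a) 1 1 0 0 1 \<phi> \<phi>"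
  let ?\<xi> = "lin3 0 1 1 - Const 1 * poly_at \<phi> (lin3 0 0 1)"
  have par: "params3b (0::'a) 1 1 0 0 1 \<phi> \<phi>" by (simp add: params3b_def \<phi>)
  have degP: "pm_deg ?P = d" using assms \<phi> by (simp add: pm_deg_fam3b)
  have inv: "pm_inv ?P = shear3 (0 / 1) (0 / 1) (- \<phi>) (- \<phi>) ?\<xi> (lin3 0 0 1)"
    using pm_inv_eqI[OF is_inverse_fam3b_1[of 1 1 "0::'a" 0 1 0 \<phi> \<phi>]] by simp
  have "pm_deg (pm_inv ?P) = d\<^sup>2"
  proof (rule antisym)
    show "pm_deg (pm_inv ?P) \<le> d\<^sup>2"
      using pm_deg_inv_fam3b_le[of 1 1 \<phi> \<phi> "0::'a" 0 1 0] \<phi> degP by simp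
    interpret C: comm_ring_hom "\<lambda>c::'a. [:c:]" by (rule comm_ring_hom_const_poly)
    \<comment> \<open>Restriction to the third axis: both linear forms become the parameter t, and
      the first component of the inverse becomes -(t - t^d)^d, of degree d^2 since d is at least
      2.\<close>
    define e where "e i = (if i = 2 then [:0, 1:] else (0::'a poly))" for i :: nat
    interpret m: comm_ring_hom "meval (\<lambda>c::'a. [:c:]) e" by (rule C.comm_ring_hom_meval)
    let ?m = "meval (\<lambda>c::'a. [:c:]) e"
    have lin: "?m (lin3 x y 1) = [:0, 1:]" for x y
      by (simp add: lin3_def m.hom_add m.hom_mult e_def)
    have \<xi>: "?m ?\<xi> = [:0, 1:] - \<phi>"
      by (simp only: m.hom_minus m.hom_mult lin meval_poly_at_pcompose pcompose_idR Const.hom_one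
          m.hom_one mult_1)
    have "Polynomial.degree ([:0, 1:] - \<phi>) = d"
      using assms \<phi>(2) degree_add_eq_right[of "[:0, 1:]" "- \<phi>"] by simp
    then have "Polynomial.degree (pcompose (- \<phi>) ([:0, 1:] - \<phi>)) = d\<^sup>2"
      using \<phi>(2) by (simp add: degree_pcompose power2_eq_square)
    moreover have "?m (pm_inv ?P $ 0) = pcompose (- \<phi>) ([:0, 1:] - \<phi>)"
      unfolding inv shear3_simps m.hom_add meval_poly_at_pcompose \<xi> by (simp add: e_def)
    ultimately have "d\<^sup>2 = Polynomial.degree (?m (pm_inv ?P $ 0))" by (simp only:)
    also have "Polynomial.degree (?m (pm_inv ?P $ 0)) \<le> total_degree (pm_inv ?P $ 0)"
      by (rule degree_meval_le) (simp add: e_def)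
    also have "total_degree (pm_inv ?P $ 0) \<le> pm_deg (pm_inv ?P)"
      by (rule total_degree_le_pm_deg) (simp add: inv)
    finally show "d\<^sup>2 \<le> pm_deg (pm_inv ?P)" .
  qed
  then show ?thesis using par degP by blast
qed

lemma poly_map_vec_2:
  "poly_map 2 (vec_of_list [f, g]) \<longleftrightarrow> vars f \<subseteq> {..<2} \<and> vars g \<subseteq> {..<2}"
  by (auto simp: poly_map_def less_2_cases_iff carrier_vecI)

lemma shear3_uminus:
  "shear3 \<alpha> \<beta> (- \<phi>) (- \<psi>) \<xi> \<eta> = vec_of_list
     [Var 0 - poly_at \<phi> \<xi>,
      Var 1 - poly_at \<psi> \<eta>,
      Var 2 + Const \<alpha> * poly_at \<phi> \<xi> + Const \<beta> * poly_at \<psi> \<eta>]"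
  by (simp add: shear3_def poly_at_uminus)

theorem theorem1p1:
  shows
  "(\<comment> \<open>general equivalence\<close>
    \<forall>n\<ge>2. \<forall>f :: 'a::field_char_0 mpoly vec. perturbation n f \<longrightarrow>
      (J (pm_id n + f) = 1 \<longleftrightarrow> (\<Sum>k=1..n. E k (jacobian f)) = 0))
   \<and>
   (\<comment> \<open>(i), general part\<close>
    \<forall>f g :: 'a mpoly. perturbation 2 (vec_of_list [f, g]) \<and> pd 0 f + pd 1 g = 0 \<longrightarrow>
      (\<exists>h. vars h \<subseteq> {..<2} \<and> f = pd 1 h \<and> g = - pd 0 h) \<and>
      (\<forall>h. vars h \<subseteq> {..<2} \<and> f = pd 1 h \<and> g = - pd 0 h \<longrightarrow>
        (J (pm_id 2 + vec_of_list [f, g]) = 1 \<longleftrightarrow>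
         pd2 0 0 h * pd2 1 1 h - (pd2 0 1 h)^2 = 0)))
   \<and>
   (\<comment> \<open>(i), the family\<close>
    \<forall>(a::'a) b \<sigma>. uterms_ge 3 \<sigma> \<longrightarrow>
      (let \<xi> = lin2 a b; h = poly_at \<sigma> \<xi>; P = fam2 a b \<sigma> in
        pd2 0 0 h * pd2 1 1 h - (pd2 0 1 h)^2 = 0 \<and>
        P = pm_id 2 + vec_of_list [pd 1 h, - pd 0 h] \<and>
        perturbation 2 (vec_of_list [pd 1 h, - pd 0 h]) \<and>
        J P = 1 \<and>
        Const a * P $ 0 + Const b * P $ 1 = \<xi> \<and>
        is_inverse 2 P (vec_of_list
          [Var 0 - Const b * poly_at (pderiv \<sigma>) \<xi>,
           Var 1 + Const a * poly_at (pderiv \<sigma>) \<xi>]) \<and>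
        pm_deg (pm_inv P) = pm_deg P))
   \<and>
   (\<forall>d\<ge>2. \<exists>(a::'a) b \<sigma>. uterms_ge 3 \<sigma> \<and> pm_deg (fam2 a b \<sigma>) = d)
   \<and>
   (\<comment> \<open>(ii), general part\<close>
    \<forall>f g h :: 'a mpoly.
      perturbation 3 (vec_of_list [f, g, h]) \<and> pd 0 f + pd 1 g + pd 2 h = 0 \<longrightarrow>
      (let potential = (\<lambda>A B C.
          vars A \<subseteq> {..<3} \<and> vars B \<subseteq> {..<3} \<and> vars C \<subseteq> {..<3} \<and>
          f = pd 1 C - pd 2 B \<and> g = pd 2 A - pd 0 C \<and> h = pd 0 B - pd 1 A)
       in
       (\<exists>A B C. potential A B C) \<and>
       (\<forall>A B C. potential A B C \<longrightarrow>
        (J (pm_id 3 + vec_of_list [f, g, h]) = 1 \<longleftrightarrow>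
         det (mat_of_rows_list 2
           [[pd2 0 1 C - pd2 0 2 B, pd2 1 1 C - pd2 1 2 B],
            [pd2 0 2 A - pd2 0 0 C, pd2 1 2 A - pd2 0 1 C]]) +
         det (mat_of_rows_list 2
           [[pd2 1 2 A - pd2 0 1 C, pd2 2 2 A - pd2 0 2 C],
            [pd2 0 1 B - pd2 1 1 A, pd2 0 2 B - pd2 1 2 A]]) +
         det (mat_of_rows_list 2
           [[pd2 0 1 C - pd2 0 2 B, pd2 1 2 C - pd2 2 2 B],
            [pd2 0 0 B - pd2 0 1 A, pd2 0 2 B - pd2 1 2 A]]) +
         det (mat_of_rows_list 3
           [[pd2 0 1 C - pd2 0 2 B, pd2 1 1 C - pd2 1 2 B, pd2 1 2 C - pd2 2 2 B],
            [pd2 0 2 A - pd2 0 0 C, pd2 1 2 A - pd2 0 1 C, pd2 2 2 A - pd2 0 2 C],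
            [pd2 0 0 B - pd2 0 1 A, pd2 0 1 B - pd2 1 1 A, pd2 0 2 B - pd2 1 2 A]]) = 0))))
   \<and>
   (\<comment> \<open>(ii-a)\<close>
    \<forall>(a::'a) b c \<phi> \<psi>. c \<noteq> 0 \<and> uterms_ge 2 \<phi> \<and> uterms_ge 2 \<psi> \<longrightarrow>
      (let \<xi> = lin3 a b c; P = fam3a a b c \<phi> \<psi> in
        perturbation 3 (P - pm_id 3) \<and>
        J P = 1 \<and>
        Const a * P $ 0 + Const b * P $ 1 + Const c * P $ 2 = \<xi> \<and>
        is_inverse 3 P (vec_of_list
          [Var 0 - poly_at \<phi> \<xi>,
           Var 1 - poly_at \<psi> \<xi>,
           Var 2 + Const (a / c) * poly_at \<phi> \<xi> + Const (b / c) * poly_at \<psi> \<xi>]) \<and>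
        pm_deg (pm_inv P) = pm_deg P))
   \<and>
   (\<comment> \<open>(ii-b)\<close>
    \<forall>(a::'a) b c p q r \<phi> \<psi>. params3b a b c p q r \<phi> \<psi> \<longrightarrow>
      (let P = fam3b a b c p q r \<phi> \<psi>;
           Q = (\<lambda>\<xi> \<eta>. vec_of_list
             [Var 0 - poly_at \<phi> \<xi>,
              Var 1 - poly_at \<psi> \<eta>,
              Var 2 + Const (a / c) * poly_at \<phi> \<xi> + Const (q / r) * poly_at \<psi> \<eta>])
       in
        perturbation 3 (P - pm_id 3) \<and>
        J P = 1 \<and>
        (a * r = c * p \<and> b * r \<noteq> c * q \<longrightarrow>
          (let \<eta> = lin3 p q r;
               \<xi> = lin3 a b c - Const (b - c * q / r) * poly_at \<psi> \<eta>
           in is_inverse 3 P (Q \<xi> \<eta>))) \<and>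
        (b * r = c * q \<and> a * r \<noteq> c * p \<longrightarrow>
          (let \<xi> = lin3 a b c;
               \<eta> = lin3 p q r - Const (p - a * r / c) * poly_at \<phi> \<xi>
           in is_inverse 3 P (Q \<xi> \<eta>))) \<and>
        pm_deg (pm_inv P) \<le> (pm_deg P)^2))
   \<and>
   (\<forall>d\<ge>2. \<exists>(a::'a) b c p q r \<phi> \<psi>. params3b a b c p q r \<phi> \<psi> \<and>
      pm_deg (fam3b a b c p q r \<phi> \<psi>) = d \<and>
      pm_deg (pm_inv (fam3b a b c p q r \<phi> \<psi>)) = d^2)
   \<and>
   (\<comment> \<open>(iii)\<close>
    \<forall>n\<ge>2. \<forall>(a :: nat \<Rightarrow> 'a) \<phi>. a (n - 1) \<noteq> 0 \<and> (\<forall>i<n - 1. uterms_ge 2 (\<phi> i)) \<longrightarrow>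
      (let \<xi> = lin n a; P = famn n a \<phi> in
        perturbation n (P - pm_id n) \<and>
        J P = 1 \<and>
        (\<Sum>i<n. Const (a i) * P $ i) = \<xi> \<and>
        is_inverse n P (vec n (\<lambda>i. if i < n - 1 then Var i - poly_at (\<phi> i) \<xi>
          else Var (n - 1) + (\<Sum>j<n - 1. Const (a j / a (n - 1)) * poly_at (\<phi> j) \<xi>))) \<and>
        pm_deg (pm_inv P) = pm_deg P))"
proof (intro conjI, goal_cases)
  case 1
  show ?case
    by (auto simp: J_id_add perturbation_def dest!: poly_map_carrier)
next
  case 2
  show ?case
  proof (intro allI impI, elim conjE)
    fix f g :: "'a mpoly"
    assume pert: "perturbation 2 (vec_of_list [f, g])" and div: "pd 0 f + pd 1 g = 0"
    have "vars f \<subseteq> {..<2}" "vars g \<subseteq> {..<2}"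
      using pert unfolding perturbation_def poly_map_vec_2 by blast+
    with div show "(\<exists>h. vars h \<subseteq> {..<2} \<and> f = pd 1 h \<and> g = - pd 0 h) \<and>
      (\<forall>h. vars h \<subseteq> {..<2} \<and> f = pd 1 h \<and> g = - pd 0 h \<longrightarrow>
        (J (pm_id 2 + vec_of_list [f, g]) = 1 \<longleftrightarrow> pd2 0 0 h * pd2 1 1 h - (pd2 0 1 h)^2 = 0))"
      using ex_potential_2[of 0 1 f g "{..<2}"] J_potential_2[of f _ g] by auto
  qed
next
  case 3
  show ?case
    unfolding Let_def by (intro allI impI conjI fam2_properties)
next
  case 4
  show ?case using ex_fam2_deg by blast
next
  case 5
  have vars: "vars f \<subseteq> {..<3}" "vars g \<subseteq> {..<3}" "vars h \<subseteq> {..<3}"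
    if "perturbation 3 (vec_of_list [f, g, h])" for f g h :: "'a mpoly"
    using that unfolding perturbation_def poly_map_vec_3 by blast+
  show ?case
    unfolding Let_def
    by (intro allI impI, elim conjE)
      (intro conjI allI impI ex_potential_3 J_potential_3 vars, (elim conjE, assumption | simp)+)
next
  case 6
  show ?case
    unfolding Let_def by (intro allI impI conjI fam3a_properties) simp_all
next
  case 7
  show ?case
    \<comment> \<open>The inequality of two truth values in \<open>params3b\<close> encodes "exactly
      one" and yields the disjunction that \<open>J_fam3b\<close> and
      \<open>pm_deg_inv_fam3b_le\<close> take; folding with \<open>shear3_uminus\<close> recognises
      the stated inverse as a \<open>shear3\<close>.\<close>
    unfolding params3b_def Let_def shear3_uminus[symmetric]
    by (intro allI impI conjI perturbation_fam3b J_fam3b is_inverse_fam3b_1 is_inverse_fam3b_2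
        pm_deg_inv_fam3b_le) auto
next
  case 8
  show ?case using ex_fam3b_deg by blast
next
  case 9
  show ?case
    unfolding Let_def by (intro allI impI conjI famn_properties) simp_all
qed

end
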